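(* Let $\varphi\in\mathcal{AC}$ satisfy, for each $i\in\mathcal{S}$, the following two conditions: (a) $\varphi(T,i)=g(T,i)$; (b) at every $t\in[0,T]$ where $\frac{d}{dt}\varphi(t,i)$ exists and $\varphi(t,i)<g(t,i)$, one has $\frac{d}{dt}\varphi(t,i)\le -H_i(t,\varphi(t))$. Let $\hat u_\varphi\in\mathcal{U}_{\mathrm{fb}}$ be a feedback strategy of the first player such that, for all $t\in[0,T]$, $i\in\mathcal{S}$, $$\hat u_\varphi(t,i)\in\operatorname*{Argmin}_{u\in U}\ \max_{v\in V}\Bigl[\sum_{j\in\mathcal{S}}Q_{i,j}(t,u,v)\varphi(t,j)+h(t,i,u,v)\Bigr],$$ and, for $t_0\in[0,T]$, let $$\hat\tau_{\varphi,t_0}(\omega)=\min\{t\in[t_0,T]:\varphi(t,\omega(t))=g(t,\omega(t))\}.$$ Then, for every $t_0\in[0,T]$, $i_0\in\mathcal{S}$ and each $\beta\in\mathcal{V}_{t_0}$, $$\mathbb{E}^{\hat u_\varphi,\beta}_{t_0,i_0}G^{\hat u_\varphi,\beta}_{t_0}(\hat\tau_{\varphi,t_0})\le\varphi(t_0,i_0).$$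
   Context: **Data and standing assumptions.** $T>0$; $\mathcal{S}=\{1,\dots,d\}$; $U,V$ are the control spaces of the first and second player; for $(t,u,v)\in[0,T]\times U\times V$, $Q(t,u,v)=(Q_{i,j}(t,u,v))_{i,j=1}^d$ is a Kolmogorov matrix, i.e. $Q_{i,j}(t,u,v)\ge 0$ for $i\ne j$ and $\sum_{j\in\mathcal{S}}Q_{i,j}(t,u,v)=0$; $g:[0,T]\times\mathcal{S}\to\mathbb{R}$ and $h:[0,T]\times\mathcal{S}\times U\times V\to\mathbb{R}$. It is assumed that: (1) $U$ and $V$ are compact; (2) $Q_{i,j}$, $g(\cdot,i)$ and $h(\cdot,i,\cdot,\cdot)$ are continuous for all $i,j$; (3) $g$ is Lipschitz continuous in the time variable; (4) for all $t\in[0,T]$, $i\in\mathcal{S}$, $w\in\mathbb{R}^d$, $$\min_{u\in U}\max_{v\in V}\Bigl[\sum_{j\in\mathcal{S}}Q_{i,j}(t,u,v)w_j+h(t,i,u,v)\Bigr]=\max_{v\in V}\min_{u\in U}\Bigl[\sum_{j\in\mathcal{S}}Q_{i,j}(t,u,v)w_j+h(t,i,u,v)\Bigr].$$ The common value is denoted $H_i(t,w)$. **Path space.** For $t_0\in[0,T]$, $\Omega_{t_0}=D([t_0,T],\mathcal{S})$ is the space of càdlàg functions from $[t_0,T]$ to $\mathcal{S}$, with Borel $\sigma$-algebra $\mathcal{F}_{t_0}$. For $t\in[t_0,T]$, $\mathcal{F}_{t_0,t}$ is the $\sigma$-algebra of all sets $\{\omega\in\Omega_{t_0}:\omega|_{[t_0,t]}\in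 B\}$ with $B$ Borel in $D([t_0,t],\mathcal{S})$, and $\mathbb{F}_{t_0}=\{\mathcal{F}_{t_0,t}\}_{t\in[t_0,T]}$. **Function class.** $\mathcal{AC}$ is the set of functions $\phi:[0,T]\times\mathcal{S}\to\mathbb{R}$ such that $t\mapsto\phi(t,i)$ is absolutely continuous for each $i$; $\phi(t)$ denotes the vector $(\phi(t,1),\dots,\phi(t,d))^T$. $\frac{\partial}{\partial t}\phi(s,\omega(s))$ denotes the time derivative of $\phi(\cdot,i)$ at $s$ with $i=\omega(s)$. **Strategies.** $\mathcal{U}_{\mathrm{fb}}$ is the set of feedback strategies of the first player: maps $[0,T]\times\mathcal{S}\to U$ measurable in time. $\mathcal{U}_{t_0}$ (resp. $\mathcal{V}_{t_0}$) is the set of strategies with memory of the first (resp. second) player: $\mathbb{F}_{t_0}$-progressively measurable processes on $[t_0,T]\times\Omega_{t_0}$ with values in $U$ (resp. $V$). A feedback strategy $u$ is identified with the strategy with memory $(t,\omega)\mapsto u(t,\omega(t))$. **Probability and payoff.** For $\alpha\in\mathcal{U}_{t_0}$, $\beta\in\mathcal{V}_{t_0}$, $i_0\in\mathcal{S}$, $\mathbb{P}^{\alpha,\beta}_{t_0,i_0}$ is the probability on $\mathcal{F}_{t_0}$ generated by $\alpha,\beta,t_0,i_0$, i.e. such that $\mathbb{P}^{\alpha,\beta}_{t_0,i_0}(\omega(t_0)=i_0)=1$ and, for every $\phi\in\mathcal{AC}$, the process $$\phi(t,\omega(t))-\int_{t_0}^t\Bigl[\tfrac{\partial}{\partial t}\phi(t',\omega(t'))+\sum_{j\in\mathcal{S}}Q_{\omega(t'),j}(t',\alpha(t',\omega),\beta(t',\omega))\phi(t',j)\Bigr]dt'$$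 is a $(\mathbb{P}^{\alpha,\beta}_{t_0,i_0},\mathbb{F}_{t_0})$-martingale. $\mathbb{E}^{\alpha,\beta}_{t_0,i_0}$ is the corresponding expectation. Put $G^{\alpha,\beta}_{t_0}(t,\omega)=g(t,\omega(t))+\int_{t_0}^t h(t',\omega(t'),\alpha(t',\omega),\beta(t',\omega))\,dt'$; for a stopping time $\tau$, $G^{\alpha,\beta}_{t_0}(\tau)$ denotes $\omega\mapsto G^{\alpha,\beta}_{t_0}(\tau(\omega),\omega)$.
   Formalization: The formal theorem also assumes φ(t,i) ≤ g(t,i) for all t in [0,T] and i in S; without it the claim fails, e.g. for d=1, Q=0, T=1, g=0, h=1, φ(t)=(1−t)/10, where (b) is vacuous and the expected payoff from t0=0 is 1 > φ(0)=1/10. *)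

theory Defs
  imports "HOL-Probability.Probability"
begin

section \<open>The game\<close>

text \<open>
  The state space is a finite type \<open>'s\<close>, of arbitrary cardinality \<open>d\<close>; vectors indexed by the
  states are elements of \<open>real ^ 's\<close>, and \<open>\<phi> t $ i\<close> stands for \<open>\<phi>(t, i)\<close>. The control spaces are
  subsets of arbitrary topological spaces.
\<close>

definition kolmogorov_matrix :: "real ^ 's ^ 's \<Rightarrow> bool" where
  "kolmogorov_matrix A \<longleftrightarrow>
     (\<forall>i j. i \<noteq> j \<longrightarrow> 0 \<le> A $ i $ j) \<and> (\<forall>i. (\<Sum>j\<in>UNIV. A $ i $ j) = 0)"

definition pre_hamiltonian ::
  "(real \<Rightarrow> 'u \<Rightarrow> 'v \<Rightarrow> real ^ 's ^ 's) \<Rightarrow> (real \<Rightarrow> 's \<Rightarrow> 'u \<Rightarrow> 'v \<Rightarrow> real) \<Rightarrow>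
    real \<Rightarrow> 's \<Rightarrow> real ^ 's \<Rightarrow> 'u \<Rightarrow> 'v \<Rightarrow> real" where
  "pre_hamiltonian Q h t i w u v = (\<Sum>j\<in>UNIV. Q t u v $ i $ j * w $ j) + h t i u v"

text \<open>
  Minima and maxima over the control spaces are written as infima and suprema; they are attained
  because the control spaces are compact and nonempty and the data are continuous.
\<close>

definition hamiltonian ::
  "'u set \<Rightarrow> 'v set \<Rightarrow> (real \<Rightarrow> 'u \<Rightarrow> 'v \<Rightarrow> real ^ 's ^ 's) \<Rightarrow>
    (real \<Rightarrow> 's \<Rightarrow> 'u \<Rightarrow> 'v \<Rightarrow> real) \<Rightarrow> real \<Rightarrow> 's \<Rightarrow> real ^ 's \<Rightarrow> real" where
  "hamiltonian U V Q h t i w = (INF u\<in>U. SUP v\<in>V. pre_hamiltonian Q h t i w u v)"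

locale stopping_game =
  fixes T :: real
    and U :: "'u::topological_space set"
    and V :: "'v::topological_space set"
    and Q :: "real \<Rightarrow> 'u \<Rightarrow> 'v \<Rightarrow> real ^ 's ^ 's"
    and g :: "real \<Rightarrow> 's \<Rightarrow> real"
    and h :: "real \<Rightarrow> 's \<Rightarrow> 'u \<Rightarrow> 'v \<Rightarrow> real"
  assumes T_pos: "T > 0"
    and U_nonempty: "U \<noteq> {}"
    and V_nonempty: "V \<noteq> {}"
    and Q_kolmogorov:
      "\<And>t u v. t \<in> {0..T} \<Longrightarrow> u \<in> U \<Longrightarrow> v \<in> V \<Longrightarrow> kolmogorov_matrix (Q t u v)"
    and U_compact: "compact U"
    and V_compact: "compact V"
    and Q_continuous:
      "\<And>i j. continuous_on ({0..T} \<times> U \<times> V) (\<lambda>(t, u, v). Q t u v $ i $ j)"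
    and g_continuous: "\<And>i. continuous_on {0..T} (\<lambda>t. g t i)"
    and h_continuous: "\<And>i. continuous_on ({0..T} \<times> U \<times> V) (\<lambda>(t, u, v). h t i u v)"
    and g_lipschitz: "\<exists>L. \<forall>i. L-lipschitz_on {0..T} (\<lambda>t. g t i)"
    and isaacs:
      "\<And>t i w. t \<in> {0..T} \<Longrightarrow>
        (INF u\<in>U. SUP v\<in>V. pre_hamiltonian Q h t i w u v) =
        (SUP v\<in>V. INF u\<in>U. pre_hamiltonian Q h t i w u v)"


section \<open>Absolutely continuous functions\<close>

definition absolutely_continuous_on :: "real set \<Rightarrow> (real \<Rightarrow> real) \<Rightarrow> bool" where
  "absolutely_continuous_on I f \<longleftrightarrow>
     (\<forall>\<epsilon>>0. \<exists>\<delta>>0. \<forall>(n::nat) x y.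
        (\<forall>k<n. x k \<in> I \<and> y k \<in> I \<and> x k \<le> y k) \<and>
        disjoint_family_on (\<lambda>k. {x k<..<y k}) {..<n} \<and>
        (\<Sum>k<n. y k - x k) < \<delta> \<longrightarrow>
        (\<Sum>k<n. \<bar>f (y k) - f (x k)\<bar>) < \<epsilon>)"

definition AC :: "real \<Rightarrow> (real \<Rightarrow> real ^ 's) set" where
  "AC T = {\<phi>. \<forall>i. absolutely_continuous_on {0..T} (\<lambda>t. \<phi> t $ i)}"

text \<open>
  The derivative is relative to \<open>{0..T}\<close>, hence one-sided at the end points. Where the derivative
  does not exist the value is unspecified; for \<open>\<phi> \<in> AC T\<close> this is a null set of times.
\<close>

definition time_deriv :: "real \<Rightarrow> (real \<Rightarrow> real ^ 's) \<Rightarrow> real \<Rightarrow> 's \<Rightarrow> real" where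
  "time_deriv T \<phi> t i = vector_derivative (\<lambda>s. \<phi> s $ i) (at t within {0..T})"


section \<open>Path space\<close>

text \<open>
  Paths on \<open>{a..b}\<close> are functions with the value \<open>undefined\<close> outside \<open>{a..b}\<close>. The state space
  carries the discrete topology, so limits are expressed by eventual equality.
\<close>

definition cadlag_on :: "real \<Rightarrow> real \<Rightarrow> (real \<Rightarrow> 's) \<Rightarrow> bool" where
  "cadlag_on a b \<omega> \<longleftrightarrow>
     (\<forall>t\<in>{a..<b}. \<forall>\<^sub>F s in at_right t. \<omega> s = \<omega> t) \<and>
     (\<forall>t\<in>{a<..b}. \<exists>i. \<forall>\<^sub>F s in at_left t. \<omega> s = i)"

definition path_space :: "real \<Rightarrow> real \<Rightarrow> (real \<Rightarrow> 's) set" where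
  "path_space a b = {\<omega> \<in> extensional {a..b}. cadlag_on a b \<omega>}"

definition time_changes :: "real \<Rightarrow> real \<Rightarrow> (real \<Rightarrow> real) set" where
  "time_changes a b =
     {r. strict_mono_on {a..b} r \<and> continuous_on {a..b} r \<and> r ` {a..b} = {a..b}}"

text \<open>The Skorokhod distance for the discrete metric \<open>of_bool (i \<noteq> j)\<close> on the states.\<close>

definition skorokhod_dist :: "real \<Rightarrow> real \<Rightarrow> (real \<Rightarrow> 's) \<Rightarrow> (real \<Rightarrow> 's) \<Rightarrow> real" where
  "skorokhod_dist a b \<omega> \<omega>' =
     Inf {\<epsilon>. \<epsilon> > 0 \<and> (\<exists>r\<in>time_changes a b. \<forall>s\<in>{a..b}.
            \<bar>r s - s\<bar> \<le> \<epsilon> \<and> of_bool (\<omega> s \<noteq> \<omega>' (r s)) \<le> \<epsilon>)}"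

definition skorokhod_open :: "real \<Rightarrow> real \<Rightarrow> (real \<Rightarrow> 's) set \<Rightarrow> bool" where
  "skorokhod_open a b A \<longleftrightarrow>
     A \<subseteq> path_space a b \<and>
     (\<forall>\<omega>\<in>A. \<exists>\<epsilon>>0. \<forall>\<omega>'\<in>path_space a b. skorokhod_dist a b \<omega> \<omega>' < \<epsilon> \<longrightarrow> \<omega>' \<in> A)"

definition path_borel :: "real \<Rightarrow> real \<Rightarrow> (real \<Rightarrow> 's) measure" where
  "path_borel a b = sigma (path_space a b) {A. skorokhod_open a b A}"

definition path_filtration :: "real \<Rightarrow> real \<Rightarrow> real \<Rightarrow> (real \<Rightarrow> 's) measure" where
  "path_filtration t0 T t =
     vimage_algebra (path_space t0 T) (\<lambda>\<omega>. restrict \<omega> {t0..t}) (path_borel t0 t)"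


section \<open>Strategies\<close>

definition feedback_strategies ::
  "real \<Rightarrow> 'u::topological_space set \<Rightarrow> (real \<Rightarrow> 's \<Rightarrow> 'u) set" where
  "feedback_strategies T U =
     {u. \<forall>i. (\<lambda>t. u t i) \<in> restrict_space borel {0..T} \<rightarrow>\<^sub>M restrict_space borel U}"

definition memory_strategies ::
  "real \<Rightarrow> real \<Rightarrow> 'u::topological_space set \<Rightarrow> (real \<Rightarrow> (real \<Rightarrow> 's) \<Rightarrow> 'u) set" where
  "memory_strategies t0 T U =
     {\<alpha>. \<forall>t\<in>{t0..T}. (\<lambda>(s, \<omega>). \<alpha> s \<omega>) \<in>
        restrict_space borel {t0..t} \<Otimes>\<^sub>M path_filtration t0 T t \<rightarrow>\<^sub>M restrict_space borel U}"

definition of_feedback :: "(real \<Rightarrow> 's \<Rightarrow> 'u) \<Rightarrow> real \<Rightarrow> (real \<Rightarrow> 's) \<Rightarrow> 'u" where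
  "of_feedback u t \<omega> = u t (\<omega> t)"


section \<open>Probability and payoff\<close>

definition martingale_on ::
  "'w measure \<Rightarrow> (real \<Rightarrow> 'w measure) \<Rightarrow> real set \<Rightarrow> (real \<Rightarrow> 'w \<Rightarrow> real) \<Rightarrow> bool" where
  "martingale_on P F I X \<longleftrightarrow>
     (\<forall>t\<in>I. subalgebra P (F t)) \<and>
     (\<forall>s\<in>I. \<forall>t\<in>I. s \<le> t \<longrightarrow> sets (F s) \<subseteq> sets (F t)) \<and>
     (\<forall>t\<in>I. X t \<in> borel_measurable (F t) \<and> integrable P (X t)) \<and>
     (\<forall>s\<in>I. \<forall>t\<in>I. s \<le> t \<longrightarrow> (AE \<omega> in P. real_cond_exp P (F s) (X t) \<omega> = X s \<omega>))"

definition dynkin_process ::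
  "real \<Rightarrow> (real \<Rightarrow> 'u \<Rightarrow> 'v \<Rightarrow> real ^ 's ^ 's) \<Rightarrow> real \<Rightarrow> (real \<Rightarrow> (real \<Rightarrow> 's) \<Rightarrow> 'u) \<Rightarrow>
    (real \<Rightarrow> (real \<Rightarrow> 's) \<Rightarrow> 'v) \<Rightarrow> (real \<Rightarrow> real ^ 's) \<Rightarrow> real \<Rightarrow> (real \<Rightarrow> 's) \<Rightarrow> real" where
  "dynkin_process T Q t0 \<alpha> \<beta> \<phi> t \<omega> =
     \<phi> t $ \<omega> t -
     (LINT s:{t0..t}|lebesgue. time_deriv T \<phi> s (\<omega> s) +
        (\<Sum>j\<in>UNIV. Q s (\<alpha> s \<omega>) (\<beta> s \<omega>) $ \<omega> s $ j * \<phi> s $ j))"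

text \<open>\<open>generated_law T Q t0 i0 \<alpha> \<beta> P\<close>: \<open>P\<close> is the probability generated by \<open>\<alpha>, \<beta>, t0, i0\<close>.\<close>

definition generated_law ::
  "real \<Rightarrow> (real \<Rightarrow> 'u \<Rightarrow> 'v \<Rightarrow> real ^ 's ^ 's) \<Rightarrow> real \<Rightarrow> 's \<Rightarrow>
    (real \<Rightarrow> (real \<Rightarrow> 's) \<Rightarrow> 'u) \<Rightarrow> (real \<Rightarrow> (real \<Rightarrow> 's) \<Rightarrow> 'v) \<Rightarrow>
    (real \<Rightarrow> 's) measure \<Rightarrow> bool" where
  "generated_law T Q t0 i0 \<alpha> \<beta> P \<longleftrightarrow>
     prob_space P \<and> space P = path_space t0 T \<and> sets P = sets (path_borel t0 T) \<and>
     measure P {\<omega> \<in> space P. \<omega> t0 = i0} = 1 \<and>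
     (\<forall>\<phi>\<in>AC T.
        martingale_on P (path_filtration t0 T) {t0..T} (dynkin_process T Q t0 \<alpha> \<beta> \<phi>))"

definition payoff ::
  "(real \<Rightarrow> 's \<Rightarrow> real) \<Rightarrow> (real \<Rightarrow> 's \<Rightarrow> 'u \<Rightarrow> 'v \<Rightarrow> real) \<Rightarrow> real \<Rightarrow>
    (real \<Rightarrow> (real \<Rightarrow> 's) \<Rightarrow> 'u) \<Rightarrow> (real \<Rightarrow> (real \<Rightarrow> 's) \<Rightarrow> 'v) \<Rightarrow>
    real \<Rightarrow> (real \<Rightarrow> 's) \<Rightarrow> real" where
  "payoff g h t0 \<alpha> \<beta> t \<omega> =
     g t (\<omega> t) + (LINT s:{t0..t}|lebesgue. h s (\<omega> s) (\<alpha> s \<omega>) (\<beta> s \<omega>))"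

text \<open>
  For a path in \<open>path_space t0 T\<close> the minimum exists when \<open>\<phi>\<close> and \<open>g\<close> are continuous in time and
  agree at time \<open>T\<close>, because paths are right-continuous.
\<close>

definition hitting_time ::
  "real \<Rightarrow> (real \<Rightarrow> 's \<Rightarrow> real) \<Rightarrow> (real \<Rightarrow> real ^ 's) \<Rightarrow> real \<Rightarrow> (real \<Rightarrow> 's) \<Rightarrow> real" where
  "hitting_time T g \<phi> t0 \<omega> = (LEAST t. t \<in> {t0..T} \<and> \<phi> t $ \<omega> t = g t (\<omega> t))"

end

theory Submission
  imports Defs
begin

text \<open>
  Along the play, consider the Dynkin process \<open>X\<close> of \<open>\<phi>\<close>: the value \<open>\<phi>(t, \<omega>(t))\<close> minus the integral of
  the drift, where the drift is the time derivative of \<open>\<phi>\<close> plus the generator applied to \<open>\<phi>\<close>.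
  It is a martingale starting in \<open>\<phi>(t0, i0)\<close>. Before the first contact \<open>\<tau>\<close> of \<open>\<phi>\<close> with the
  obstacle \<open>g\<close>, the path sees \<open>\<phi> < g\<close>; there the differential inequality bounds the time derivative by
  the negative Hamiltonian, and the minimizing feedback guarantees that the generator term plus the running
  payoff is at most the Hamiltonian whatever the opponent does. Hence the running payoff is
  at most the negative drift, and since \<open>\<phi> = g\<close> at time \<open>\<tau>\<close>, the payoff at \<open>\<tau>\<close> is at most \<open>X\<close>
  at \<open>\<tau>\<close> (\<open>payoff_le_dynkin\<close>). Optional stopping (\<open>optional_stopping\<close>) gives \<open>X\<close> at \<open>\<tau>\<close> the
  expectation \<open>\<phi>(t0, i0)\<close> (\<open>dynkin_stopped\<close>).

  Three points need substantial support. The differential inequality is assumed only where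
  \<open>\<phi>\<close> is differentiable, and the drift must be integrable: an absolutely continuous function is a
  difference of monotone functions, which have integrable derivatives almost everywhere by a
  theorem of Lebesgue, proved here by Vitali coverings (\<open>absolutely_continuous_derivative\<close>). The
  contact time has to be a stopping time of the raw path filtration, whose \<open>\<sigma>\<close>-algebras come
  from the Skorokhod topology (\<open>hitting_event_adapted\<close>). Finally, the coefficients
  composed with the strategies must be jointly measurable although the control spaces are arbitrary compact
  spaces, possibly without a countable base (\<open>borel_measurable_compose_compact\<close>).
\<close>

section \<open>Monotone functions are differentiable almost everywhere\<close>

lemma emeasure_Union_le_finite:
  assumes C: "countable C" and sets: "\<And>c. c \<in> C \<Longrightarrow> A c \<in> sets M"
    and le: "\<And>D. finite D \<Longrightarrow> D \<subseteq> C \<Longrightarrow> emeasure M (\<Union>c\<in>D. A c) \<le> K"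
  shows "emeasure M (\<Union>c\<in>C. A c) \<le> K"
proof (cases "C = {}")
  case True
  then show ?thesis by simp
next
  case False
  define B where "B n = (\<Union>c\<in>from_nat_into C ` {..n}. A c)" for n
  have inC: "from_nat_into C k \<in> C" for k
    using False by (simp add: from_nat_into)
  have "(SUP n. emeasure M (B n)) = emeasure M (\<Union>n. B n)"
  proof (rule SUP_emeasure_incseq)
    show "range B \<subseteq> sets M"
      using inC sets by (auto simp: B_def intro!: sets.finite_UN)
    show "incseq B"
      by (force simp: incseq_def B_def)
  qed
  moreover have "(\<Union>n. B n) = (\<Union>c\<in>C. A c)"
  proof
    show "(\<Union>n. B n) \<subseteq> (\<Union>c\<in>C. A c)"
      using inC by (auto simp: B_def)
    show "(\<Union>c\<in>C. A c) \<subseteq> (\<Union>n. B n)"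
      using from_nat_into_surj[OF C] by (fastforce simp: B_def)
  qed
  moreover have "emeasure M (B n) \<le> K" for n
    unfolding B_def using inC by (intro le) auto
  ultimately show ?thesis
    by (metis SUP_least)
qed

text \<open>
  Vitali's covering theorem in the form used below: balls of the line are compact intervals, stored
  as pairs of end points. The exceptional null set \<open>N\<close> lets the caller discard points that have no
  small covering interval, such as end points of an earlier covering.
\<close>

lemma vitali_intervals:
  fixes E N :: "real set"
  assumes N: "negligible N"
    and cover: "\<And>x d. x \<in> E - N \<Longrightarrow> 0 < d \<Longrightarrow>
        \<exists>(a, b)\<in>K. a < b \<and> b - a < d \<and> x \<in> {a..b}"
  obtains C where "countable C" "C \<subseteq> K" "\<And>a b. (a, b) \<in> C \<Longrightarrow> a < b"
    "disjoint_family_on (\<lambda>(a, b). {a..b}) C"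
    "negligible (E - (\<Union>(a, b)\<in>C. {a..b}))"
proof -
  define K' where "K' = {p \<in> K. fst p < snd p}"
  have cb: "cball ((fst p + snd p) / 2) ((snd p - fst p) / 2) = {fst p..snd p}" for p :: "real \<times> real"
    by (auto simp: cball_eq_atLeastAtMost field_simps)
  have "\<exists>i. i \<in> K' \<and> x \<in> cball ((fst i + snd i) / 2) ((snd i - fst i) / 2) \<and> (snd i - fst i) / 2 < d"
    if "x \<in> E - N" "0 < d" for x d
    using cover[OF that] unfolding cb by (force simp: K'_def)
  then obtain C where C: "countable C" "C \<subseteq> K'"
     "pairwise (\<lambda>i j. disjnt (cball ((fst i + snd i) / 2) ((snd i - fst i) / 2))
         (cball ((fst j + snd j) / 2) ((snd j - fst j) / 2))) C"
     "negligible ((E - N) - (\<Union>i \<in> C. cball ((fst i + snd i) / 2) ((snd i - fst i) / 2)))"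
    using Vitali_covering_theorem_cballs[of K' "\<lambda>p. (snd p - fst p) / 2" "E - N" "\<lambda>p. (fst p + snd p) / 2"]
    by (auto simp: K'_def)
  show thesis
  proof
    show "disjoint_family_on (\<lambda>(a, b). {a..b}) C"
      using C(3) unfolding cb pairwise_def disjoint_family_on_def disjnt_def
      by (simp add: case_prod_beta)
    show "negligible (E - (\<Union>(a, b)\<in>C. {a..b}))"
      using negligible_Un[OF C(4) N] unfolding cb
      by (rule negligible_subset) (auto simp: case_prod_beta)
  qed (use C in \<open>auto simp: K'_def\<close>)
qed

text \<open>
  Covering a set by intervals that carry some bounded quantity bounds its outer measure. The outer
  measure is used because the sets of points with prescribed difference quotients need not be known
  to be measurable. Bounding only finite disjoint families suffices, by continuity from below.
\<close>

lemma outer_measure_vitali_le: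
  fixes E N :: "real set"
  assumes N: "negligible N"
    and cover: "\<And>x d. x \<in> E - N \<Longrightarrow> 0 < d \<Longrightarrow>
        \<exists>(a, b)\<in>K. a < b \<and> b - a < d \<and> x \<in> {a..b}"
    and bound: "\<And>D. finite D \<Longrightarrow> D \<subseteq> K \<Longrightarrow> (\<And>a b. (a, b) \<in> D \<Longrightarrow> a < b) \<Longrightarrow>
        disjoint_family_on (\<lambda>(a, b). {a..b}) D \<Longrightarrow> (\<Sum>(a, b)\<in>D. b - a) \<le> B"
  shows "outer_measure_of lebesgue E \<le> ennreal B"
proof -
  obtain C where C: "countable C" "C \<subseteq> K" "\<And>a b. (a, b) \<in> C \<Longrightarrow> a < b"
    "disjoint_family_on (\<lambda>(a, b). {a..b}) C"
    "negligible (E - (\<Union>(a, b)\<in>C. {a..b}))"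
    using vitali_intervals[OF N cover] by metis
  let ?J = "\<Union>(a, b)\<in>C. {a..b}" and ?N = "E - (\<Union>(a, b)\<in>C. {a..b})"
  have Jsets: "?J \<in> sets lebesgue"
    using C(1) by (intro sets.countable_UN') auto
  have null: "?N \<in> null_sets lebesgue"
    using C(5) by (simp add: negligible_iff_null_sets)
  have "outer_measure_of lebesgue E \<le> outer_measure_of lebesgue (?J \<union> ?N)"
    by (rule outer_measure_of_mono) auto
  also have "\<dots> = emeasure lebesgue (?J \<union> ?N)"
    using Jsets null by (intro outer_measure_of_eq sets.Un) auto
  also have "\<dots> = emeasure lebesgue ?J"
    by (rule emeasure_Un_null_set[OF Jsets null])
  also have "\<dots> \<le> ennreal B"
  proof (rule emeasure_Union_le_finite[OF C(1)])
    fix D assume D: "finite D" "D \<subseteq> C"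
    have "emeasure lebesgue (\<Union>c\<in>D. case c of (a, b) \<Rightarrow> {a..b})
        \<le> (\<Sum>c\<in>D. emeasure lebesgue (case c of (a, b) \<Rightarrow> {a..b}))"
      by (rule emeasure_subadditive_finite[OF D(1)]) auto
    also have "\<dots> = (\<Sum>c\<in>D. ennreal (case c of (a, b) \<Rightarrow> b - a))"
      using D(2) by (intro sum.cong) (auto dest!: C(3) subsetD)
    also have "\<dots> = ennreal (\<Sum>(a, b)\<in>D. b - a)"
      using D(2) by (intro sum_ennreal) (auto dest!: C(3) subsetD)
    also have "\<dots> \<le> ennreal B"
    proof (intro ennreal_leI bound D(1))
      show "D \<subseteq> K" using D(2) C(2) by blast
      show "a < b" if "(a, b) \<in> D" for a b using C(3) D(2) that by blast
      show "disjoint_family_on (\<lambda>(a, b). {a..b}) D"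
        using D(2) C(4) by (rule disjoint_family_on_mono)
    qed
    finally show "emeasure lebesgue (\<Union>c\<in>D. case c of (a, b) \<Rightarrow> {a..b}) \<le> ennreal B" .
  qed auto
  finally show ?thesis .
qed

text \<open>
  Disjoint closed intervals can be listed from left to right, so the increments of a monotone
  function over them telescope; the induction removes the rightmost interval.
\<close>

lemma sum_increments_le:
  fixes F :: "real \<Rightarrow> real"
  assumes F: "mono F" and "finite D"
    and "\<And>a b. (a, b) \<in> D \<Longrightarrow> A \<le> a \<and> a < b \<and> b \<le> B" and "A \<le> B"
    and "disjoint_family_on (\<lambda>(a, b). {a..b}) D"
  shows "(\<Sum>(a, b)\<in>D. F b - F a) \<le> F B - F A"
  using assms(2-)
proof (induction "card D" arbitrary: D B)
  case 0
  have "D = {}" using "0.hyps" "0.prems"(1) by (metis card_eq_0_iff)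
  then show ?case using monoD[OF F "0.prems"(3)] by simp
next
  case (Suc n)
  have "D \<noteq> {}" using Suc.hyps(2) by (metis card.empty nat.distinct(1))
  then have "snd ` D \<noteq> {}" "finite (snd ` D)" using Suc.prems(1) by auto
  from Max_in[OF this(2,1)] obtain a b where "(a, b) \<in> D" "b = Max (snd ` D)" by auto
  moreover have "d \<le> Max (snd ` D)" if "(c, d) \<in> D" for c d
    using Suc.prems(1) that by (intro Max_ge) force+
  ultimately have ab: "(a, b) \<in> D" "\<And>c d. (c, d) \<in> D \<Longrightarrow> d \<le> b" by auto
  have less: "d < a" if "(c, d) \<in> D - {(a, b)}" for c d
  proof (rule ccontr)
    assume "\<not> d < a"
    then have "d \<in> {a..b} \<inter> {c..d}" using that ab Suc.prems(2)[of c d] by auto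
    moreover have "{a..b} \<inter> {c..d} = {}"
    proof -
      have "(c, d) \<in> D" "(a, b) \<noteq> (c, d)" using that by blast+
      from disjoint_family_onD[OF Suc.prems(4) ab(1) this] show ?thesis by simp
    qed
    ultimately show False by auto
  qed
  have "(\<Sum>(a, b)\<in>D - {(a, b)}. F b - F a) \<le> F a - F A"
  proof (rule Suc.hyps(1))
    show "n = card (D - {(a, b)})" using Suc.hyps(2) ab Suc.prems(1) by simp
    show "disjoint_family_on (\<lambda>(a, b). {a..b}) (D - {(a, b)})"
      using Suc.prems(4) by (rule disjoint_family_on_mono[rotated]) auto
    show "A \<le> c \<and> c < d \<and> d \<le> a" if "(c, d) \<in> D - {(a, b)}" for c d
      using less[OF that] Suc.prems(2)[of c d] that by auto
    show "finite (D - {(a, b)})" using Suc.prems(1) by simp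
    show "A \<le> a" using Suc.prems(2)[OF ab(1)] by simp
  qed
  moreover have "F b \<le> F B"
    using Suc.prems(2)[OF ab(1)] by (intro monoD[OF F]) auto
  ultimately show ?case
    using ab(1) Suc.prems(1) by (simp add: sum.remove[of D "(a, b)"])
qed

lemma negligible_outer_measure_0:
  assumes "outer_measure_of lebesgue E = 0"
  shows "negligible (E :: real set)"
proof -
  obtain H where "H \<in> sets lebesgue" "E \<subseteq> H" "outer_measure_of lebesgue E = emeasure lebesgue H"
    using outer_measure_of_attain[of E lebesgue] by auto
  then show ?thesis
    using assms by (metis negligible_iff_null_sets negligible_subset null_setsI)
qed

lemma slope_interval:
  fixes F :: "real \<Rightarrow> real"
  assumes "\<exists>\<^sub>F y in at x. R ((F y - F x) / (y - x))" "0 < d"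
  shows "\<exists>a b. a < b \<and> b - a < d \<and> x \<in> {a..b} \<and> R ((F b - F a) / (b - a))"
proof -
  have "\<exists>\<^sub>F y in at x. R ((F y - F x) / (y - x)) \<and> (y \<noteq> x \<and> dist y x < d)"
    using assms by (intro frequently_eventually_frequently) (auto simp: eventually_at)
  then obtain y where y: "R ((F y - F x) / (y - x))" "y \<noteq> x" "dist y x < d"
    using frequently_ex by blast
  show ?thesis
  proof (cases "x < y")
    case True
    then show ?thesis using y by (intro exI[of _ x] exI[of _ y]) (auto simp: dist_real_def)
  next
    case False
    moreover have "(F x - F y) / (x - y) = (F y - F x) / (y - x)"
      using y(2) by (simp add: field_simps)
    ultimately show ?thesis using y by (intro exI[of _ y] exI[of _ x]) (auto simp: dist_real_def)
  qed
qed

text \<open>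
  If every point of a set has small intervals of slope above \<open>q\<close> around it, disjoint ones among them
  have total length below the total increase divided by \<open>q\<close>; let \<open>q\<close> tend to infinity.
\<close>

lemma negligible_infinite_slope:
  fixes F :: "real \<Rightarrow> real"
  assumes F: "mono F" and bdd: "\<And>x. c0 \<le> F x \<and> F x \<le> c1"
  shows "negligible {x. \<forall>q. \<exists>\<^sub>F y in at x. q < (F y - F x) / (y - x)}" (is "negligible ?E")
proof -
  have *: "outer_measure_of lebesgue ?E \<le> ennreal ((c1 - c0) / q)" if "q > 0" for q
  proof (rule outer_measure_vitali_le[where N = "{}" and K = "{(a, b). a < b \<and> q < (F b - F a) / (b - a)}"])
    fix x d :: real assume x: "x \<in> ?E - {}" "0 < d"
    have "\<exists>\<^sub>F y in at x. q < (F y - F x) / (y - x)" using x(1) by blast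
    from slope_interval[OF this x(2)] obtain a b
      where "a < b" "b - a < d" "x \<in> {a..b}" "q < (F b - F a) / (b - a)" by blast
    then show "\<exists>(a, b)\<in>{(a, b). a < b \<and> q < (F b - F a) / (b - a)}. a < b \<and> b - a < d \<and> x \<in> {a..b}"
      by (intro bexI[of _ "(a, b)"]) simp_all
  next
    fix D assume D: "finite D" "D \<subseteq> {(a, b). a < b \<and> q < (F b - F a) / (b - a)}"
      "\<And>a b. (a, b) \<in> D \<Longrightarrow> a < b" "disjoint_family_on (\<lambda>(a, b). {a..b}) D"
    define R where "R = Max (insert 0 ((\<lambda>(a, b). \<bar>a\<bar> + \<bar>b\<bar>) ` D))"
    have R: "\<bar>a\<bar> + \<bar>b\<bar> \<le> R" if "(a, b) \<in> D" for a b
      unfolding R_def using D(1) that by (intro Max_ge) force+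
    have "0 \<le> R" unfolding R_def using D(1) by (intro Max_ge) auto
    moreover have "- R \<le> a \<and> a < b \<and> b \<le> R" if "(a, b) \<in> D" for a b
      using R[OF that] D(3)[OF that] by linarith
    ultimately obtain A B where "A \<le> B" "\<And>a b. (a, b) \<in> D \<Longrightarrow> A \<le> a \<and> a < b \<and> b \<le> B"
      by (metis add_increasing2 add_le_same_cancel1 neg_le_0_iff_le order_trans)
    then have "(\<Sum>(a, b)\<in>D. F b - F a) \<le> F B - F A"
      using sum_increments_le[OF F D(1)] D(4) by blast
    moreover have "q * (\<Sum>(a, b)\<in>D. b - a) \<le> (\<Sum>(a, b)\<in>D. F b - F a)"
      unfolding sum_distrib_left using D(2) by (intro sum_mono) (auto simp: field_simps)
    moreover have "F B - F A \<le> c1 - c0" using bdd[of A] bdd[of B] by auto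
    ultimately show "(\<Sum>(a, b)\<in>D. b - a) \<le> (c1 - c0) / q"
      using that by (simp add: field_simps)
  qed simp
  have "((\<lambda>q. ennreal ((c1 - c0) / q)) \<longlongrightarrow> ennreal 0) at_top"
    by (intro tendsto_ennrealI tendsto_divide_0[OF tendsto_const] filterlim_at_top_imp_at_infinity filterlim_ident)
  moreover have "\<forall>\<^sub>F q in at_top. outer_measure_of lebesgue ?E \<le> ennreal ((c1 - c0) / q)"
    using eventually_gt_at_top[of 0] by eventually_elim (rule *)
  ultimately have "outer_measure_of lebesgue ?E \<le> ennreal 0"
    by (intro tendsto_lowerbound) auto
  then show ?thesis by (intro negligible_outer_measure_0) simp
qed


text \<open>
  The heart of Lebesgue's theorem. Let \<open>m\<close> be the outer measure of the set. Cover it first by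
  disjoint intervals of slope below \<open>p\<close> inside an open set of measure at most \<open>m + e\<close>: the total
  increase over them is at most \<open>p (m + e)\<close>. Then cover it again by intervals of slope above \<open>q\<close>
  lying inside the first ones: their total length is at most \<open>p (m + e) / q\<close>. Hence
  \<open>m \<le> p (m + e) / q\<close> for all \<open>e\<close>, which forces \<open>m = 0\<close> because \<open>p < q\<close>.
\<close>

lemma negligible_slope_gap:
  fixes F :: "real \<Rightarrow> real"
  assumes F: "mono F" and pq: "0 < p" "p < q"
  shows "negligible ({x. (\<exists>\<^sub>F y in at x. (F y - F x) / (y - x) < p) \<and>
                         (\<exists>\<^sub>F y in at x. q < (F y - F x) / (y - x))} \<inter> {A..B})" (is "negligible ?E")
proof -
  obtain H where H: "H \<in> sets lebesgue" "?E \<subseteq> H" "outer_measure_of lebesgue ?E = emeasure lebesgue H"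
    using outer_measure_of_attain[of ?E lebesgue] by auto
  have "outer_measure_of lebesgue ?E \<le> outer_measure_of lebesgue {A..B}"
    by (rule outer_measure_of_mono) auto
  also have "\<dots> \<le> ennreal (max 0 (B - A))" by (cases "A \<le> B") auto
  finally have "outer_measure_of lebesgue ?E \<noteq> \<infinity>" by (auto simp: top_unique)
  then obtain m where m: "outer_measure_of lebesgue ?E = ennreal m" "0 \<le> m"
    by (cases "outer_measure_of lebesgue ?E") auto
  have step: "m \<le> p * (m + e) / q" if e: "e > 0" for e
  proof -
    obtain S where S: "open S" "H \<subseteq> S" "S - H \<in> lmeasurable" "emeasure lebesgue (S - H) < ennreal e"
      using sets_lebesgue_outer_open[OF H(1) e] by blast
    have "emeasure lebesgue S = emeasure lebesgue H + emeasure lebesgue (S - H)"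
      using S(1,2) H(1) by (subst plus_emeasure) (auto intro: fmeasurableD[OF S(3)] simp: Un_absorb1)
    also have "\<dots> \<le> ennreal m + ennreal e"
      using m(1) H(3) S(4) by (intro add_mono) auto
    finally have Sle: "emeasure lebesgue S \<le> ennreal (m + e)"
      using m(2) e by (simp add: ennreal_plus[symmetric] del: ennreal_plus)
    define K1 where "K1 = {(a, b). a < b \<and> {a..b} \<subseteq> S \<and> (F b - F a) / (b - a) < p}"
    have cover: "\<exists>(a, b)\<in>K1. a < b \<and> b - a < d \<and> x \<in> {a..b}" if x: "x \<in> ?E - {}" "0 < d" for x d
    proof -
      have "x \<in> S" using x(1) H(2) S(2) by blast
      then obtain r where r: "r > 0" "ball x r \<subseteq> S" using S(1) openE by blast
      have "\<exists>\<^sub>F y in at x. (F y - F x) / (y - x) < p" using x(1) by blast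
      from slope_interval[OF this, of "min d r"] obtain a b
        where ab: "a < b" "b - a < min d r" "x \<in> {a..b}" "(F b - F a) / (b - a) < p" using x(2) r by auto
      have "{a..b} \<subseteq> ball x r" using ab(2,3) by (auto simp: dist_real_def)
      then have "(a, b) \<in> K1" using r(2) ab(1,4) by (simp add: K1_def)
      then show ?thesis using ab(1-3) by (intro bexI[of _ "(a, b)"]) simp_all
    qed
    obtain C where C: "countable C" "C \<subseteq> K1"
      "\<And>a b. (a, b) \<in> C \<Longrightarrow> a < b" "disjoint_family_on (\<lambda>(a, b). {a..b}) C"
      "negligible (?E - (\<Union>(a, b)\<in>C. {a..b}))"
    proof (rule vitali_intervals[where E = ?E and N = "{}" and K = K1])
    qed (use cover that in blast)+
    \<comment> \<open>Points outside the first covering and end points of its intervals admit no second interval inside.\<close>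
    define N where "N = (?E - (\<Union>(a, b)\<in>C. {a..b})) \<union> (fst ` C \<union> snd ` C)"
    have N: "negligible N"
      unfolding N_def using C(1,5)
      by (intro negligible_Un) (auto simp: negligible_iff_null_sets intro: null_sets_completionI countable_imp_null_set_lborel)
    define K2 where "K2 = {(a, b). (\<exists>(c, d)\<in>C. c \<le> a \<and> b \<le> d) \<and> a < b \<and> q < (F b - F a) / (b - a)}"
    have "outer_measure_of lebesgue ?E \<le> ennreal (p * (m + e) / q)"
    proof (rule outer_measure_vitali_le[OF N, where K = K2])
      fix x d :: real assume x: "x \<in> ?E - N" "0 < d"
      then obtain c c' where c: "(c, c') \<in> C" "x \<in> {c..c'}" unfolding N_def by blast
      have "c \<in> fst ` C" "c' \<in> snd ` C" using c(1) by force+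
      with x c have xc: "c < x" "x < c'" unfolding N_def by (auto simp: less_le)
      have "\<exists>\<^sub>F y in at x. q < (F y - F x) / (y - x)" using x(1) by blast
      from slope_interval[OF this, of "min d (min (x - c) (c' - x))"] obtain a b
        where ab: "a < b" "b - a < min d (min (x - c) (c' - x))" "x \<in> {a..b}" "q < (F b - F a) / (b - a)"
        using x(2) xc by auto
      have "c \<le> a" "b \<le> c'" using ab(2,3) by auto
      then have "(a, b) \<in> K2" using c(1) ab(1,4) by (auto simp: K2_def)
      then show "\<exists>(a, b)\<in>K2. a < b \<and> b - a < d \<and> x \<in> {a..b}"
        using ab(1-3) by (intro bexI[of _ "(a, b)"]) simp_all
    next
      fix D assume D: "finite D" "D \<subseteq> K2" "\<And>a b. (a, b) \<in> D \<Longrightarrow> a < b"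
        "disjoint_family_on (\<lambda>(a, b). {a..b}) D"
      have "\<forall>z\<in>D. \<exists>w. w \<in> C \<and> fst w \<le> fst z \<and> snd z \<le> snd w"
        using D(2) unfolding K2_def by fastforce
      \<comment> \<open>\<open>\<pi>\<close> sends a steep interval to the flat one that contains it.\<close>
      then obtain \<pi> where \<pi>: "\<And>z. z \<in> D \<Longrightarrow> \<pi> z \<in> C \<and> fst (\<pi> z) \<le> fst z \<and> snd z \<le> snd (\<pi> z)"
        by metis
      have inner: "(\<Sum>(a, b)\<in>{z \<in> D. \<pi> z = w}. F b - F a) \<le> F (snd w) - F (fst w)"
        if w: "w \<in> \<pi> ` D" for w
      proof (rule sum_increments_le[OF F])
        have wC: "w \<in> C" using w \<pi> by auto
        then show "fst w \<le> snd w" using C(3)[of "fst w" "snd w"] by simp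
        show "disjoint_family_on (\<lambda>(a, b). {a..b}) {z \<in> D. \<pi> z = w}"
          using D(4) by (rule disjoint_family_on_mono[rotated]) auto
        show "fst w \<le> a \<and> a < b \<and> b \<le> snd w" if "(a, b) \<in> {z \<in> D. \<pi> z = w}" for a b
          using \<pi>[of "(a, b)"] D(3)[of a b] that by auto
      qed (use D(1) in auto)
      have steep: "q * (b - a) \<le> F b - F a" if "(a, b) \<in> D" for a b
      proof -
        have "a < b" "q < (F b - F a) / (b - a)" using D(2) that by (auto simp: K2_def)
        then show ?thesis by (simp add: field_simps)
      qed
      have flat: "F (snd w) - F (fst w) \<le> p * (snd w - fst w)" if "w \<in> \<pi> ` D" for w
      proof -
        have "w \<in> K1" using \<pi> C(2) that by auto
        then have "fst w < snd w" "(F (snd w) - F (fst w)) / (snd w - fst w) < p" by (auto simp: K1_def)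
        then show ?thesis by (simp add: field_simps)
      qed
      have \<pi>C: "\<pi> ` D \<subseteq> C" using \<pi> by auto
      have length: "(\<Sum>w\<in>\<pi> ` D. snd w - fst w) \<le> m + e"
      proof -
        have less: "fst w < snd w" if "w \<in> \<pi> ` D" for w
          using C(3)[of "fst w" "snd w"] \<pi>C that by auto
        have "ennreal (\<Sum>w\<in>\<pi> ` D. snd w - fst w) = (\<Sum>w\<in>\<pi> ` D. ennreal (snd w - fst w))"
          using less by (intro sum_ennreal[symmetric]) (simp add: less_imp_le)
        also have "\<dots> = (\<Sum>w\<in>\<pi> ` D. emeasure lebesgue {fst w..snd w})"
          using less by (intro sum.cong) (auto simp: less_imp_le)
        also have "\<dots> = emeasure lebesgue (\<Union>w\<in>\<pi> ` D. {fst w..snd w})"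
        proof (rule sum_emeasure)
          have "disjoint_family_on (\<lambda>(a, b). {a..b}) (\<pi> ` D)"
            using \<pi>C C(4) by (rule disjoint_family_on_mono)
          then show "disjoint_family_on (\<lambda>w. {fst w..snd w}) (\<pi> ` D)"
            by (simp add: case_prod_beta')
        qed (use D(1) in auto)
        also have "\<dots> \<le> emeasure lebesgue S"
        proof (rule emeasure_mono)
          have "{fst w..snd w} \<subseteq> S" if "w \<in> \<pi> ` D" for w
          proof -
            have "w \<in> K1" using \<pi>C C(2) that by blast
            then show ?thesis by (auto simp: K1_def)
          qed
          then show "(\<Union>w\<in>\<pi> ` D. {fst w..snd w}) \<subseteq> S" by blast
        qed (use S(1) in simp)
        also have "\<dots> \<le> ennreal (m + e)" by (rule Sle)
        finally show ?thesis using m(2) e by (subst (asm) ennreal_le_iff) auto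
      qed
      have "q * (\<Sum>(a, b)\<in>D. b - a) \<le> (\<Sum>(a, b)\<in>D. F b - F a)"
        unfolding sum_distrib_left using steep by (intro sum_mono) auto
      also have "\<dots> = (\<Sum>w\<in>\<pi> ` D. \<Sum>(a, b)\<in>{z \<in> D. \<pi> z = w}. F b - F a)"
        by (rule sum.image_gen[OF D(1)])
      also have "\<dots> \<le> (\<Sum>w\<in>\<pi> ` D. p * (snd w - fst w))"
        using inner flat by (intro sum_mono) (meson order_trans)
      also have "\<dots> = p * (\<Sum>w\<in>\<pi> ` D. snd w - fst w)"
        by (rule sum_distrib_left[symmetric])
      also have "\<dots> \<le> p * (m + e)"
        using length pq by (intro mult_left_mono) auto
      finally show "(\<Sum>(a, b)\<in>D. b - a) \<le> p * (m + e) / q"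
        using pq by (simp add: field_simps)
    qed
    then show ?thesis
      using m pq e by (simp add: ennreal_le_iff)
  qed
  have "((\<lambda>e. p * (m + e) / q) \<longlongrightarrow> p * (m + 0) / q) (at_right 0)"
    by (intro tendsto_intros) (use pq in auto)
  moreover have "\<forall>\<^sub>F e in at_right 0. m \<le> p * (m + e) / q"
    using eventually_at_right_less[of 0] by eventually_elim (rule step)
  ultimately have "m \<le> p * (m + 0) / q"
    by (intro tendsto_lowerbound) auto
  then have "(q - p) * m \<le> 0" using pq by (simp add: field_simps)
  then have "m = 0" using pq m(2) by (simp add: mult_le_0_iff)
  then show ?thesis using m(1) by (intro negligible_outer_measure_0) simp
qed


text \<open>
  Where the derivative fails to exist, the lower and the upper limit of the difference quotients are
  separated by two rationals, or the upper limit is infinite: countably many of the null sets above.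
\<close>

lemma negligible_not_differentiable_mono:
  fixes F :: "real \<Rightarrow> real"
  assumes F: "mono F" and bdd: "\<And>x. c0 \<le> F x \<and> F x \<le> c1"
  shows "negligible {x. \<nexists>D. (F has_real_derivative D) (at x)}"
proof -
  define G where "G x y = (F y - F x) / (y - x)" for x y
  have G_nonneg: "0 \<le> G x y" for x y
    using monoD[OF F, of x y] monoD[OF F, of y x] unfolding G_def
    by (cases "x \<le> y") (auto intro: divide_nonneg_nonneg divide_nonpos_nonpos)
  define Gap where "Gap = (\<lambda>(p::rat, q::rat, n::nat). {x. (\<exists>\<^sub>F y in at x. G x y < of_rat p) \<and>
     (\<exists>\<^sub>F y in at x. of_rat q < G x y)} \<inter> {- real n..real n})"
  define I where "I = {(p::rat, q::rat, n::nat). 0 < p \<and> p < q}"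
  have "negligible (\<Union>i\<in>I. Gap i)"
  proof -
    have "Gap i \<in> null_sets lebesgue" if "i \<in> I" for i
      using that unfolding negligible_iff_null_sets[symmetric] Gap_def I_def G_def
      by (auto simp: of_rat_less intro!: negligible_slope_gap[OF F])
    then show ?thesis
      unfolding negligible_iff_null_sets by (intro null_sets_UN') (auto intro: countableI_type)
  qed
  then have "negligible ((\<Union>i\<in>I. Gap i) \<union> {x. \<forall>q. \<exists>\<^sub>F y in at x. q < G x y})"
    using negligible_infinite_slope[OF F bdd] unfolding G_def by (intro negligible_Un)
  moreover have "{x. \<nexists>D. (F has_real_derivative D) (at x)} \<subseteq>
      (\<Union>i\<in>I. Gap i) \<union> {x. \<forall>q. \<exists>\<^sub>F y in at x. q < G x y}"
  proof (rule subsetI, rule ccontr)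
    fix x assume x: "x \<in> {x. \<nexists>D. (F has_real_derivative D) (at x)}"
      "x \<notin> (\<Union>i\<in>I. Gap i) \<union> {x. \<forall>q. \<exists>\<^sub>F y in at x. q < G x y}"
    let ?L = "Liminf (at x) (\<lambda>y. ereal (G x y))" and ?U = "Limsup (at x) (\<lambda>y. ereal (G x y))"
    have L0: "0 \<le> ?L" using G_nonneg by (intro Liminf_bounded) auto
    have LU: "?L \<le> ?U" by (intro Liminf_le_Limsup) auto
    obtain q where "\<forall>\<^sub>F y in at x. G x y \<le> q"
      using x(2) by (auto simp: not_frequently not_less)
    then have "?U \<le> ereal q" by (intro Limsup_bounded) (auto elim: eventually_mono)
    moreover have "?L = ?U"
    proof (rule ccontr)
      assume "?L \<noteq> ?U"
      with LU have "?L < ?U" by simp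
      then obtain q where q: "?L < ereal (of_rat q)" "ereal (of_rat q) < ?U"
        using ereal_dense3[of ?L ?U] by auto
      obtain p where p: "?L < ereal (of_rat p)" "ereal (of_rat p) < ereal (of_rat q)"
        using ereal_dense3[OF q(1)] by auto
      have "0 < p" "p < q"
        using p L0 by (auto simp: of_rat_less dest: le_less_trans)
      have "\<exists>\<^sub>F y in at x. G x y < of_rat p"
      proof (rule ccontr)
        assume "\<not> ?thesis"
        then have "\<forall>\<^sub>F y in at x. ereal (of_rat p) \<le> ereal (G x y)" by (simp add: not_frequently not_less)
        then have "ereal (of_rat p) \<le> ?L" by (rule Liminf_bounded)
        with p(1) show False by simp
      qed
      moreover have "\<exists>\<^sub>F y in at x. of_rat q < G x y"
      proof (rule ccontr)
        assume "\<not> ?thesis"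
        then have "\<forall>\<^sub>F y in at x. ereal (G x y) \<le> ereal (of_rat q)" by (simp add: not_frequently not_less)
        then have "?U \<le> ereal (of_rat q)" by (rule Limsup_bounded)
        with q(2) show False by simp
      qed
      moreover obtain n :: nat where "\<bar>x\<bar> \<le> real n" using real_arch_simple by blast
      ultimately have "x \<in> Gap (p, q, n)" by (auto simp: Gap_def)
      moreover have "(p, q, n) \<in> I" using \<open>0 < p\<close> \<open>p < q\<close> by (simp add: I_def)
      ultimately show False using x(2) by blast
    qed
    ultimately obtain l where l: "?U = ereal l" "?L = ereal l"
      using L0 by (cases ?U) auto
    have "((\<lambda>y. ereal (G x y)) \<longlongrightarrow> ereal l) (at x)"
      using l by (intro Liminf_eq_Limsup) auto
    then have "(F has_real_derivative l) (at x)"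
      unfolding has_field_derivative_iff G_def by simp
    with x(1) show False by blast
  qed
  ultimately show ?thesis by (rule negligible_subset)
qed

text \<open>
  Shifting the domain of integration, everything cancels except a strip of width \<open>h\<close> at each end,
  where \<open>F\<close> is constant.
\<close>

lemma nn_integral_increment:
  fixes F :: "real \<Rightarrow> real"
  assumes F: "mono F" and ab: "a \<le> b" and left: "\<And>x. x \<le> a \<Longrightarrow> F x = F a"
    and right: "\<And>x. b \<le> x \<Longrightarrow> F x = F b" and h: "0 < h"
  shows "(\<integral>\<^sup>+x. ennreal (F (x + h) - F x) \<partial>lborel) = ennreal (h * (F b - F a))"
proof (rule nn_integral_has_integral_lborel)
  have int: "F integrable_on {c..d}" for c d
    using F by (intro integrable_on_mono_on) (auto simp: mono_on_def mono_def)
  have [measurable]: "F \<in> borel_measurable borel" by (rule borel_measurable_mono[OF F])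
  show "(\<lambda>x. F (x + h) - F x) \<in> borel_measurable borel" by measurable
  show "0 \<le> F (x + h) - F x" for x using monoD[OF F, of x "x + h"] h by simp
  have "(F has_integral h * F a) {a - h..a}"
    using has_integral_const_real[of "F a" "a - h" a] h
    by (intro has_integral_eq[where f = "\<lambda>_. F a" and g = F] left[symmetric]) auto
  then have *: "(F has_integral (h * F a + integral {a..b} F)) {a - h..b}"
    using h ab by (intro has_integral_combine[OF _ _ _ integrable_integral[OF int]]) auto
  have "(F has_integral h * F b) {b..b + h}"
    using has_integral_const_real[of "F b" b "b + h"] h
    by (intro has_integral_eq[where f = "\<lambda>_. F b" and g = F] right[symmetric]) auto
  then have "(F has_integral (integral {a..b} F + h * F b)) {a..b + h}"
    using h ab by (intro has_integral_combine[OF _ _ integrable_integral[OF int]]) auto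
  then have "((F \<circ> (+) h) has_integral (integral {a..b} F + h * F b)) {a - h..b}"
    by (subst has_integral_shift_Icc_real) simp
  from has_integral_diff[OF this *]
  have "((\<lambda>x. F (x + h) - F x) has_integral h * (F b - F a)) {a - h..b}"
    by (simp add: o_def add.commute algebra_simps)
  then show "((\<lambda>x. F (x + h) - F x) has_integral h * (F b - F a)) UNIV"
  proof (rule has_integral_on_superset)
    fix x assume "x \<notin> {a - h..b}"
    then show "F (x + h) - F x = 0"
      using left[of x] left[of "x + h"] right[of x] right[of "x + h"] h by fastforce
  qed simp
qed

text \<open>
  The derivative is the limit of difference quotients that all have integral \<open>F b - F a\<close>, hence it is
  integrable by Fatou's lemma.
\<close>

lemma mono_integrable_derivative:
  fixes F :: "real \<Rightarrow> real"
  assumes F: "mono F" and ab: "a \<le> b" and left: "\<And>x. x \<le> a \<Longrightarrow> F x = F a"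
    and right: "\<And>x. b \<le> x \<Longrightarrow> F x = F b"
  obtains D where "integrable lborel D" "AE x in lborel. (F has_real_derivative D x) (at x)"
proof -
  have [measurable]: "F \<in> borel_measurable borel" by (rule borel_measurable_mono[OF F])
  define q where "q n x = (F (x + 1 / real (Suc n)) - F x) * real (Suc n)" for n x
  have [measurable]: "q n \<in> borel_measurable borel" for n unfolding q_def by measurable
  have q_nonneg: "0 \<le> q n x" for n x
    using monoD[OF F, of x "x + 1 / real (Suc n)"] by (simp add: q_def)
  define D' where "D' x = liminf (\<lambda>n. ennreal (q n x))" for x
  define D where "D x = enn2real (D' x)" for x
  have [measurable]: "D' \<in> borel_measurable borel" unfolding D'_def by measurable
  have qint: "(\<integral>\<^sup>+x. ennreal (q n x) \<partial>lborel) = ennreal (F b - F a)" for n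
  proof -
    have "(\<integral>\<^sup>+x. ennreal (q n x) \<partial>lborel)
        = (\<integral>\<^sup>+x. ennreal (real (Suc n)) * ennreal (F (x + 1 / real (Suc n)) - F x) \<partial>lborel)"
      using monoD[OF F] by (intro nn_integral_cong) (simp add: q_def ennreal_mult[symmetric] mult.commute del: of_nat_Suc)
    also have "\<dots> = ennreal (real (Suc n)) * ennreal (1 / real (Suc n) * (F b - F a))"
      by (subst nn_integral_cmult) (simp_all add: nn_integral_increment[OF F ab left right] del: of_nat_Suc)
    also have "\<dots> = ennreal (F b - F a)"
      using monoD[OF F ab] by (subst ennreal_mult[symmetric]) (auto simp: field_simps simp del: of_nat_Suc)
    finally show ?thesis .
  qed
  have "integrable lborel D"
  proof (rule integrableI_nonneg)
    have "(\<integral>\<^sup>+x. ennreal (D x) \<partial>lborel) \<le> (\<integral>\<^sup>+x. D' x \<partial>lborel)"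
      unfolding D_def by (intro nn_integral_mono) (metis ennreal_enn2real_if order_refl zero_le)
    also have "\<dots> \<le> liminf (\<lambda>n. \<integral>\<^sup>+x. ennreal (q n x) \<partial>lborel)"
      unfolding D'_def by (rule nn_integral_liminf) measurable
    also have "\<dots> = ennreal (F b - F a)"
      unfolding qint by (simp add: Liminf_const)
    finally show "(\<integral>\<^sup>+x. ennreal (D x) \<partial>lborel) < \<infinity>"
      by (simp add: le_less_trans)
    have "D = (\<lambda>x. enn2real (D' x))" by (simp add: fun_eq_iff D_def)
    then show "D \<in> borel_measurable lborel" by simp
  qed (auto simp: D_def)
  moreover have "AE x in lborel. (F has_real_derivative D x) (at x)"
  proof -
    have "F a \<le> F x \<and> F x \<le> F b" for x
      using left[of x] right[of x] monoD[OF F, of a x] monoD[OF F, of x b] monoD[OF F ab] by fastforce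
    from negligible_not_differentiable_mono[OF F this]
    have "AE x in lebesgue. \<exists>d. (F has_real_derivative d) (at x)"
      unfolding negligible_iff_null_sets by (rule AE_I') auto
    then have "AE x in lborel. \<exists>d. (F has_real_derivative d) (at x)"
      by (simp add: AE_completion_iff)
    then show ?thesis
    proof eventually_elim
      case (elim x)
      then obtain d where d: "(F has_real_derivative d) (at x)" by blast
      have "(\<lambda>n. (F (x + 1 / real (Suc n)) - F x) / (1 / real (Suc n))) \<longlonglongrightarrow> d"
      proof (rule filterlim_compose[of "\<lambda>h. (F (x + h) - F x) / h" _ "at 0"])
        show "((\<lambda>h. (F (x + h) - F x) / h) \<longlongrightarrow> d) (at 0)" using d by (simp add: DERIV_def)
        show "filterlim (\<lambda>n. 1 / real (Suc n)) (at 0) sequentially"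
          unfolding filterlim_at using LIMSEQ_inverse_real_of_nat by (simp add: inverse_eq_divide)
      qed
      then have lim: "(\<lambda>n. q n x) \<longlonglongrightarrow> d" by (simp add: q_def)
      then have "0 \<le> d" using q_nonneg by (intro LIMSEQ_le_const) auto
      have "(\<lambda>n. ennreal (q n x)) \<longlonglongrightarrow> ennreal d" using lim by (rule tendsto_ennrealI)
      then have "D' x = ennreal d" unfolding D'_def by (intro lim_imp_Liminf) auto
      then show ?case using d \<open>0 \<le> d\<close> by (simp add: D_def)
    qed
  qed
  ultimately show thesis by (rule that)
qed


section \<open>Absolutely continuous functions\<close>

text \<open>
  The sums whose supremum is the positive variation of \<open>f\<close> on \<open>{a..x}\<close>. Finite disjoint families of
  intervals replace partitions, to match the definition of absolute continuity.
\<close>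

definition pos_variations :: "(real \<Rightarrow> real) \<Rightarrow> real \<Rightarrow> real \<Rightarrow> real set" where
  "pos_variations f a x = {s. \<exists>(n::nat) u v. s = (\<Sum>k<n. max 0 (f (v k) - f (u k))) \<and>
      (\<forall>k<n. u k \<in> {a..x} \<and> v k \<in> {a..x} \<and> u k \<le> v k) \<and>
      disjoint_family_on (\<lambda>k. {u k<..<v k}) {..<n}}"

lemma pos_variationsE:
  assumes "s \<in> pos_variations f a x"
  obtains n :: nat and u v where "s = (\<Sum>k<n. max 0 (f (v k) - f (u k)))"
    "\<And>k. k < n \<Longrightarrow> u k \<in> {a..x} \<and> v k \<in> {a..x} \<and> u k \<le> v k"
    "disjoint_family_on (\<lambda>k. {u k<..<v k}) {..<n}"
proof -
  from assms obtain n :: nat and u v where *: "s = (\<Sum>k<n. max 0 (f (v k) - f (u k)))"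
    "\<forall>k<n. u k \<in> {a..x} \<and> v k \<in> {a..x} \<and> u k \<le> v k"
    "disjoint_family_on (\<lambda>k. {u k<..<v k}) {..<n}"
    unfolding pos_variations_def by blast
  show thesis using *(2) by (intro that[OF *(1) _ *(3)]) blast
qed

lemma sum_lengths_le:
  fixes u v :: "'i \<Rightarrow> real"
  assumes "finite I" "c \<le> d" and uv: "\<And>k. k \<in> I \<Longrightarrow> u k \<in> {c..d} \<and> v k \<in> {c..d} \<and> u k \<le> v k"
    and disj: "disjoint_family_on (\<lambda>k. {u k<..<v k}) I"
  shows "(\<Sum>k\<in>I. v k - u k) \<le> d - c"
proof -
  have "ennreal (\<Sum>k\<in>I. v k - u k) = (\<Sum>k\<in>I. emeasure lborel {u k<..<v k})"
    using uv by (subst sum_ennreal[symmetric]) auto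
  also have "\<dots> = emeasure lborel (\<Union>k\<in>I. {u k<..<v k})"
    using disj \<open>finite I\<close> by (intro sum_emeasure) auto
  also have "\<dots> \<le> emeasure lborel {c..d}"
    using uv by (intro emeasure_mono) force+
  also have "\<dots> = ennreal (d - c)" using \<open>c \<le> d\<close> by simp
  finally show ?thesis using \<open>c \<le> d\<close> by (simp add: ennreal_le_iff)
qed

text \<open>
  An absolutely continuous function has bounded variation: advancing \<open>x\<close> by half of the \<open>\<delta>\<close>
  belonging to \<open>\<epsilon> = 1\<close> adds at most 1 to the sums.
\<close>

lemma pos_variations_bounded:
  assumes f: "absolutely_continuous_on {a..b} f"
  shows "\<exists>K. \<forall>x\<in>{a..b}. \<forall>s\<in>pos_variations f a x. s \<le> K"
proof -
  obtain \<delta> where \<delta>: "\<delta> > 0" and AC: "\<And>(n::nat) u v. (\<forall>k<n. u k \<in> {a..b} \<and> v k \<in> {a..b} \<and> u k \<le> v k) \<Longrightarrow>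
      disjoint_family_on (\<lambda>k. {u k<..<v k}) {..<n} \<Longrightarrow> (\<Sum>k<n. v k - u k) < \<delta> \<Longrightarrow>
      (\<Sum>k<n. \<bar>f (v k) - f (u k)\<bar>) < 1"
    using f unfolding absolutely_continuous_on_def by (meson zero_less_one)
  have steps: "s \<le> real m" if "x \<in> {a..b}" "x \<le> a + real m * (\<delta> / 2)" "s \<in> pos_variations f a x" for m x s
    using that
  proof (induction m arbitrary: x s)
    case 0
    then have "x = a" by simp
    from 0(3) obtain n :: nat and u v where s: "s = (\<Sum>k<n. max 0 (f (v k) - f (u k)))"
      and uv: "\<And>k. k < n \<Longrightarrow> u k \<in> {a..x} \<and> v k \<in> {a..x} \<and> u k \<le> v k"
      and "disjoint_family_on (\<lambda>k. {u k<..<v k}) {..<n}"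
      by (rule pos_variationsE) (rule that)
    have "max 0 (f (v k) - f (u k)) = 0" if "k < n" for k
      using uv[OF that] \<open>x = a\<close> by simp
    then show ?case using s by simp
  next
    case (Suc m)
    from Suc.prems(3) obtain n :: nat and u v where s: "s = (\<Sum>k<n. max 0 (f (v k) - f (u k)))"
      and uv: "\<And>k. k < n \<Longrightarrow> u k \<in> {a..x} \<and> v k \<in> {a..x} \<and> u k \<le> v k"
      and disj: "disjoint_family_on (\<lambda>k. {u k<..<v k}) {..<n}"
      by (rule pos_variationsE) (rule that)
    define c where "c = max a (x - \<delta> / 2)"
    have c: "a \<le> c" "c \<le> x" "x - c \<le> \<delta> / 2" "c \<le> a + real m * (\<delta> / 2)"
      using Suc.prems(1,2) \<delta> by (auto simp: c_def max_def algebra_simps add_divide_distrib)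
    \<comment> \<open>Truncation by \<open>min\<close> and \<open>max\<close> cuts every interval at \<open>c\<close>; the parts may be degenerate and then contribute nothing.\<close>
    have "(\<Sum>k<n. max 0 (f (min (v k) c) - f (min (u k) c))) \<in> pos_variations f a c"
      unfolding pos_variations_def
    proof (intro CollectI exI conjI)
      show "\<forall>k<n. min (u k) c \<in> {a..c} \<and> min (v k) c \<in> {a..c} \<and> min (u k) c \<le> min (v k) c"
        using uv c by fastforce
      show "disjoint_family_on (\<lambda>k. {min (u k) c<..<min (v k) c}) {..<n}"
        using disj by (rule disjoint_family_on_bisimulation) auto
    qed simp
    then have le1: "(\<Sum>k<n. max 0 (f (min (v k) c) - f (min (u k) c))) \<le> real m"
      using c Suc.prems(1) by (intro Suc.IH) auto
    have uv2: "max (u k) c \<in> {c..x} \<and> max (v k) c \<in> {c..x} \<and> max (u k) c \<le> max (v k) c" if "k < n" for k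
      using uv[OF that] c by auto
    have disj2: "disjoint_family_on (\<lambda>k. {max (u k) c<..<max (v k) c}) {..<n}"
      using disj by (rule disjoint_family_on_bisimulation) auto
    have "(\<Sum>k<n. max (v k) c - max (u k) c) \<le> x - c"
      using uv2 c by (intro sum_lengths_le disj2) auto
    also have "\<dots> < \<delta>" using c \<delta> by simp
    finally have "(\<Sum>k<n. \<bar>f (max (v k) c) - f (max (u k) c)\<bar>) < 1"
      using uv2 c Suc.prems(1) by (intro AC disj2) force+
    have "s \<le> (\<Sum>k<n. max 0 (f (min (v k) c) - f (min (u k) c)) + \<bar>f (max (v k) c) - f (max (u k) c)\<bar>)"
      unfolding s
    proof (rule sum_mono)
      fix k assume "k \<in> {..<n}"
      then have "u k \<le> v k" using uv by simp
      then consider "v k \<le> c" | "c \<le> u k" | "u k \<le> c" "c \<le> v k" by linarith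
      then show "max 0 (f (v k) - f (u k))
          \<le> max 0 (f (min (v k) c) - f (min (u k) c)) + \<bar>f (max (v k) c) - f (max (u k) c)\<bar>"
        using \<open>u k \<le> v k\<close> by cases (simp_all add: min_absorb1 min_absorb2 max_absorb1 max_absorb2)
    qed
    also have "\<dots> \<le> real m + 1"
      unfolding sum.distrib
      using le1 \<open>(\<Sum>k<n. \<bar>f (max (v k) c) - f (max (u k) c)\<bar>) < 1\<close> by linarith
    finally show ?case by simp
  qed
  obtain m :: nat where m: "(b - a) / (\<delta> / 2) \<le> real m" using real_arch_simple by blast
  then have "b \<le> a + real m * (\<delta> / 2)" using \<delta> by (simp add: field_simps)
  then have "s \<le> real m" if "x \<in> {a..b}" "s \<in> pos_variations f a x" for x s
    using that by (intro steps[of x]) auto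
  then show ?thesis by blast
qed

text \<open>
  Jordan decomposition, with the positive variation as the first function. Both parts are continued
  by constants to the whole line, the form in which the results on monotone functions apply.
\<close>

lemma absolutely_continuous_mono_diff:
  assumes f: "absolutely_continuous_on {a..b} f" and ab: "a \<le> b"
  obtains P N where "mono P" "mono N" "\<And>x. x \<in> {a..b} \<Longrightarrow> f x = P x - N x"
    "\<And>x. x \<le> a \<Longrightarrow> P x = P a" "\<And>x. x \<le> a \<Longrightarrow> N x = N a"
    "\<And>x. b \<le> x \<Longrightarrow> P x = P b" "\<And>x. b \<le> x \<Longrightarrow> N x = N b"
proof -
  obtain K where K: "\<And>x s. x \<in> {a..b} \<Longrightarrow> s \<in> pos_variations f a x \<Longrightarrow> s \<le> K"
    using pos_variations_bounded[OF f] by blast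
  define p where "p x = Sup (pos_variations f a x)" for x
  have bdd: "bdd_above (pos_variations f a x)" if "x \<in> {a..b}" for x
    using K[OF that] by (auto simp: bdd_above_def)
  have ne: "pos_variations f a x \<noteq> {}" for x
  proof -
    have "0 \<in> pos_variations f a x"
      unfolding pos_variations_def by (intro CollectI exI[of _ 0] exI) (auto simp: disjoint_family_on_def)
    then show ?thesis by blast
  qed
  have p_step: "p x + max 0 (f y - f x) \<le> p y" if xy: "a \<le> x" "x \<le> y" "y \<le> b" for x y
  proof -
    have "s \<le> p y - max 0 (f y - f x)" if s: "s \<in> pos_variations f a x" for s
    proof -
      from s obtain n :: nat and u v where s: "s = (\<Sum>k<n. max 0 (f (v k) - f (u k)))"
        and uv: "\<And>k. k < n \<Longrightarrow> u k \<in> {a..x} \<and> v k \<in> {a..x} \<and> u k \<le> v k"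
        and disj: "disjoint_family_on (\<lambda>k. {u k<..<v k}) {..<n}"
        by (rule pos_variationsE) (rule that)
      define u' where "u' = u(n := x)"
      define v' where "v' = v(n := y)"
      have "s + max 0 (f y - f x) = (\<Sum>k<Suc n. max 0 (f (v' k) - f (u' k)))"
        unfolding s u'_def v'_def by simp
      moreover have "\<forall>k<Suc n. u' k \<in> {a..y} \<and> v' k \<in> {a..y} \<and> u' k \<le> v' k"
        using uv xy by (force simp: u'_def v'_def less_Suc_eq)
      moreover have "disjoint_family_on (\<lambda>k. {u' k<..<v' k}) {..<Suc n}"
        unfolding lessThan_Suc
      proof (subst disjoint_family_on_insert)
        have "{u' n<..<v' n} \<inter> {u' k<..<v' k} = {}" if "k < n" for k
          using uv[OF that] that by (auto simp: u'_def v'_def)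
        moreover have "disjoint_family_on (\<lambda>k. {u' k<..<v' k}) {..<n}"
          using disj by (rule disjoint_family_on_bisimulation) (auto simp: u'_def v'_def)
        ultimately show "{u' n<..<v' n} \<inter> (\<Union>k\<in>{..<n}. {u' k<..<v' k}) = {} \<and>
            disjoint_family_on (\<lambda>k. {u' k<..<v' k}) {..<n}" by blast
      qed simp
      ultimately have "s + max 0 (f y - f x) \<in> pos_variations f a y"
        unfolding pos_variations_def by blast
      then have "s + max 0 (f y - f x) \<le> p y"
        unfolding p_def using xy by (intro cSup_upper bdd) auto
      then show ?thesis by simp
    qed
    then have "p x \<le> p y - max 0 (f y - f x)"
      unfolding p_def by (intro cSup_least ne)
    then show ?thesis by simp
  qed
  define cl where "cl x = max a (min b x)" for x
  have cl: "a \<le> cl x" "cl x \<le> b" "x \<le> y \<Longrightarrow> cl x \<le> cl y" for x y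
    using ab by (auto simp: cl_def)
  have step: "p (cl x) + max 0 (f (cl y) - f (cl x)) \<le> p (cl y)" if "x \<le> y" for x y
    using cl that by (intro p_step) auto
  show thesis
  proof (rule that[of "\<lambda>x. p (cl x)" "\<lambda>x. p (cl x) - f (cl x)"])
    have "p (cl x) \<le> p (cl y)" "f (cl y) - f (cl x) \<le> p (cl y) - p (cl x)" if "x \<le> y" for x y
      using step[OF that] by linarith+
    then show "mono (\<lambda>x. p (cl x))" "mono (\<lambda>x. p (cl x) - f (cl x))"
      by (auto intro!: monoI simp: algebra_simps)
  qed (use ab in \<open>auto simp: cl_def\<close>)
qed

lemma absolutely_continuous_derivative:
  assumes f: "absolutely_continuous_on {a..b} f" and ab: "a \<le> b"
  obtains D where "integrable lborel D"
    "AE x in lborel. x \<in> {a..b} \<longrightarrow> (f has_real_derivative D x) (at x within {a..b})"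
proof -
  obtain P N where PN: "mono P" "mono N" "\<And>x. x \<in> {a..b} \<Longrightarrow> f x = P x - N x"
    "\<And>x. x \<le> a \<Longrightarrow> P x = P a" "\<And>x. x \<le> a \<Longrightarrow> N x = N a"
    "\<And>x. b \<le> x \<Longrightarrow> P x = P b" "\<And>x. b \<le> x \<Longrightarrow> N x = N b"
    using absolutely_continuous_mono_diff[OF f ab] by blast
  obtain D1 where D1: "integrable lborel D1" "AE x in lborel. (P has_real_derivative D1 x) (at x)"
    using mono_integrable_derivative[OF PN(1) ab PN(4,6)] by blast
  obtain D2 where D2: "integrable lborel D2" "AE x in lborel. (N has_real_derivative D2 x) (at x)"
    using mono_integrable_derivative[OF PN(2) ab PN(5,7)] by blast
  show thesis
  proof
    show "integrable lborel (\<lambda>x. D1 x - D2 x)" using D1 D2 by simp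
    show "AE x in lborel. x \<in> {a..b} \<longrightarrow> (f has_real_derivative D1 x - D2 x) (at x within {a..b})"
      using D1(2) D2(2)
    proof eventually_elim
      case (elim x)
      then have "((\<lambda>x. P x - N x) has_real_derivative D1 x - D2 x) (at x within {a..b})"
        by (intro has_field_derivative_at_within[OF DERIV_diff])
      then have "(f has_real_derivative D1 x - D2 x) (at x within {a..b})" if "x \<in> {a..b}"
        by (rule has_field_derivative_transform_within[OF _ zero_less_one that]) (simp add: PN(3))
      then show ?case ..
    qed
  qed
qed

lemma absolutely_continuous_imp_continuous:
  assumes f: "absolutely_continuous_on {a..b} f"
  shows "continuous_on {a..b} f"
  unfolding continuous_on_iff
proof (intro ballI allI impI)
  fix x e :: real assume x: "x \<in> {a..b}" and e: "0 < e"
  obtain \<delta> where \<delta>: "\<delta> > 0" and AC: "\<And>(n::nat) u v. (\<forall>k<n. u k \<in> {a..b} \<and> v k \<in> {a..b} \<and> u k \<le> v k) \<Longrightarrow>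
      disjoint_family_on (\<lambda>k. {u k<..<v k}) {..<n} \<Longrightarrow> (\<Sum>k<n. v k - u k) < \<delta> \<Longrightarrow>
      (\<Sum>k<n. \<bar>f (v k) - f (u k)\<bar>) < e"
    using f e unfolding absolutely_continuous_on_def by meson
  have "dist (f y) (f x) < e" if y: "y \<in> {a..b}" "dist y x < \<delta>" for y
    using AC[of 1 "\<lambda>_. min x y" "\<lambda>_. max x y"] x y
    by (cases "x \<le> y") (auto simp: dist_real_def disjoint_family_on_def min_def max_def abs_minus_commute)
  then show "\<exists>d>0. \<forall>x'\<in>{a..b}. dist x' x < d \<longrightarrow> dist (f x') (f x) < e" using \<delta> by blast
qed

section \<open>Measurability on the path space\<close>

lemma path_space_right_constant:
  assumes "\<omega> \<in> path_space a b" "s \<in> {a..<b}"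
  obtains e where "0 < e" "s + e \<le> b" "\<And>r. s \<le> r \<Longrightarrow> r < s + e \<Longrightarrow> \<omega> r = \<omega> s"
proof -
  have "\<forall>\<^sub>F r in at_right s. \<omega> r = \<omega> s"
    using assms by (auto simp: path_space_def cadlag_on_def)
  then obtain d where d: "d > s" "\<And>r. s < r \<Longrightarrow> r < d \<Longrightarrow> \<omega> r = \<omega> s"
    unfolding eventually_at_right_field by blast
  show thesis
  proof (rule that[of "min (d - s) (b - s)"])
    show "\<omega> r = \<omega> s" if "s \<le> r" "r < s + min (d - s) (b - s)" for r
      using d(2)[of r] that by (cases "r = s") auto
  qed (use d(1) assms(2) in auto)
qed

text \<open>
  Because states are at distance 1 from each other, paths at distance below 1 agree up to the time change.
\<close>

lemma skorokhod_dist_lessD: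
  assumes "skorokhod_dist a b \<omega> \<omega>' < e" "e \<le> 1"
  shows "\<exists>r\<in>time_changes a b. \<forall>s\<in>{a..b}. \<bar>r s - s\<bar> < e \<and> \<omega>' (r s) = \<omega> s"
proof -
  let ?E = "{\<epsilon>. \<epsilon> > 0 \<and> (\<exists>r\<in>time_changes a b. \<forall>s\<in>{a..b}.
            \<bar>r s - s\<bar> \<le> \<epsilon> \<and> of_bool (\<omega> s \<noteq> \<omega>' (r s)) \<le> \<epsilon>)}"
  have "(\<lambda>s. s) \<in> time_changes a b"
    by (auto simp: time_changes_def strict_mono_on_def)
  then have "1 \<in> ?E" by (auto intro!: bexI[of _ "\<lambda>s. s"])
  then have "?E \<noteq> {}" by blast
  then obtain \<epsilon> where \<epsilon>: "\<epsilon> \<in> ?E" "\<epsilon> < e"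
    using cInf_lessD[of ?E e] assms unfolding skorokhod_dist_def by blast
  then obtain r where r: "r \<in> time_changes a b"
    "\<And>s. s \<in> {a..b} \<Longrightarrow> \<bar>r s - s\<bar> \<le> \<epsilon> \<and> of_bool (\<omega> s \<noteq> \<omega>' (r s)) \<le> \<epsilon>" by blast
  have "\<bar>r s - s\<bar> < e \<and> \<omega>' (r s) = \<omega> s" if "s \<in> {a..b}" for s
    using r(2)[OF that] \<epsilon>(2) assms(2) by (cases "\<omega> s = \<omega>' (r s)") auto
  then show ?thesis using r(1) by blast
qed

text \<open>
  Evaluation at a fixed interior time is not Skorokhod continuous, but visiting a state during an open
  time window is an open condition: a small time change keeps the visiting time inside the window.
\<close>

lemma skorokhod_open_hits:
  "skorokhod_open a b {\<omega> \<in> path_space a b. \<exists>s\<in>{a..b}. c < s \<and> s < d \<and> \<omega> s = i}"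
  unfolding skorokhod_open_def
proof (intro conjI ballI)
  fix \<omega> assume "\<omega> \<in> {\<omega> \<in> path_space a b. \<exists>s\<in>{a..b}. c < s \<and> s < d \<and> \<omega> s = i}"
  then obtain s where s: "s \<in> {a..b}" "c < s" "s < d" "\<omega> s = i" by blast
  show "\<exists>\<epsilon>>0. \<forall>\<omega>'\<in>path_space a b. skorokhod_dist a b \<omega> \<omega>' < \<epsilon> \<longrightarrow>
      \<omega>' \<in> {\<omega> \<in> path_space a b. \<exists>s\<in>{a..b}. c < s \<and> s < d \<and> \<omega> s = i}"
  proof (intro exI[of _ "min 1 (min (s - c) (d - s))"] conjI ballI impI CollectI)
    fix \<omega>' assume "skorokhod_dist a b \<omega> \<omega>' < min 1 (min (s - c) (d - s))"
    from skorokhod_dist_lessD[OF this min.cobounded1] obtain r where r: "r \<in> time_changes a b"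
      "\<bar>r s - s\<bar> < min 1 (min (s - c) (d - s))" "\<omega>' (r s) = \<omega> s"
      using s(1) by blast
    have "\<omega>' (r s) = i" using r(3) s(4) by simp
    moreover have "r s \<in> {a..b}" using r(1) s(1) by (auto simp: time_changes_def)
    moreover have "c < r s" "r s < d" using r(2) by auto
    ultimately show "\<exists>s\<in>{a..b}. c < s \<and> s < d \<and> \<omega>' s = i" by blast
  qed (use s in auto)
qed auto

text \<open>
  Time changes fix the final time, so there evaluation is continuous.
\<close>

lemma skorokhod_open_endpoint:
  assumes ab: "a \<le> b"
  shows "skorokhod_open a b {\<omega> \<in> path_space a b. \<omega> b = i}"
  unfolding skorokhod_open_def
proof (intro conjI ballI)
  fix \<omega> assume \<omega>: "\<omega> \<in> {\<omega> \<in> path_space a b. \<omega> b = i}"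
  show "\<exists>\<epsilon>>0. \<forall>\<omega>'\<in>path_space a b. skorokhod_dist a b \<omega> \<omega>' < \<epsilon> \<longrightarrow>
      \<omega>' \<in> {\<omega> \<in> path_space a b. \<omega> b = i}"
  proof (intro exI[of _ 1] conjI ballI impI CollectI)
    fix \<omega>' assume "skorokhod_dist a b \<omega> \<omega>' < 1"
    from skorokhod_dist_lessD[OF this order_refl] obtain r
      where r: "r \<in> time_changes a b" "\<omega>' (r b) = \<omega> b"
      using ab by auto
    have sm: "strict_mono_on {a..b} r" and im: "r ` {a..b} = {a..b}"
      using r(1) by (auto simp: time_changes_def)
    obtain s where s: "s \<in> {a..b}" "r s = b"
      using im ab by (metis atLeastAtMost_iff image_iff order_refl)
    have "s = b"
    proof (rule ccontr)
      assume "s \<noteq> b"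
      then have "b < r b" using strict_mono_onD[OF sm, of s b] s ab by auto
      moreover have "r b \<in> {a..b}" using im ab by auto
      ultimately show False by auto
    qed
    then show "\<omega>' b = i" using r(2) s(2) \<omega> by auto
  qed auto
qed auto

lemma space_path_borel [simp]: "space (path_borel a b) = path_space a b"
  by (auto simp: path_borel_def space_measure_of_conv)

lemma skorokhod_open_in_path_borel: "skorokhod_open a b A \<Longrightarrow> A \<in> sets (path_borel a b)"
  unfolding path_borel_def by (subst sets_measure_of) (auto simp: skorokhod_open_def)

text \<open>
  By right-continuity, a path is in the state \<open>i\<close> at time \<open>q\<close> iff it visits \<open>i\<close> in each of the windows
  \<open>(q, q + 1 / n)\<close>.
\<close>

lemma path_eval_measurable:
  assumes q: "q \<in> {a..b}"
  shows "{\<omega> \<in> path_space a b. \<omega> q = i} \<in> sets (path_borel a b)"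
proof (cases "q = b")
  case True
  then show ?thesis using q by (auto intro!: skorokhod_open_in_path_borel skorokhod_open_endpoint)
next
  case False
  let ?H = "\<lambda>n::nat. {\<omega> \<in> path_space a b. \<exists>s\<in>{a..b}. q < s \<and> s < q + 1 / real (Suc n) \<and> \<omega> s = i}"
  have "{\<omega> \<in> path_space a b. \<omega> q = i} = (\<Inter>n. ?H n)"
  proof (intro set_eqI iffI)
    fix \<omega> assume \<omega>: "\<omega> \<in> {\<omega> \<in> path_space a b. \<omega> q = i}"
    then obtain e where e: "0 < e" "q + e \<le> b" "\<And>r. q \<le> r \<Longrightarrow> r < q + e \<Longrightarrow> \<omega> r = \<omega> q"
      using path_space_right_constant[of \<omega> a b q] q False by auto
    have "\<omega> \<in> ?H n" for n
    proof -
      have "q < min (q + e) (q + 1 / real (Suc n))" using e(1) by simp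
      then obtain s where "q < s" "s < min (q + e) (q + 1 / real (Suc n))" using dense by blast
      moreover from this have "\<omega> s = i" using e(3)[of s] \<omega> by simp
      ultimately show ?thesis using e(2) \<omega> q by (auto intro!: bexI[of _ s] simp del: of_nat_Suc)
    qed
    then show "\<omega> \<in> (\<Inter>n. ?H n)" by blast
  next
    fix \<omega> assume \<omega>: "\<omega> \<in> (\<Inter>n. ?H n)"
    then obtain e where e: "0 < e" "q + e \<le> b" "\<And>r. q \<le> r \<Longrightarrow> r < q + e \<Longrightarrow> \<omega> r = \<omega> q"
      using path_space_right_constant[of \<omega> a b q] q False by auto
    obtain n where n: "1 / real (Suc n) < e" using e(1) nat_approx_posE by blast
    have "\<omega> \<in> ?H n" using \<omega> by blast
    then obtain s where "q < s" "s < q + 1 / real (Suc n)" "\<omega> s = i" by blast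
    then have "\<omega> q = i" using e(3)[of s] n by (simp del: of_nat_Suc)
    then show "\<omega> \<in> {\<omega> \<in> path_space a b. \<omega> q = i}" using \<omega> by blast
  qed
  moreover have "(\<Inter>n. ?H n) \<in> sets (path_borel a b)"
    by (intro sets.countable_INT image_subsetI skorokhod_open_in_path_borel skorokhod_open_hits) simp
  ultimately show ?thesis by simp
qed

lemma space_path_filtration [simp]: "space (path_filtration t0 T t) = path_space t0 T"
  by (simp add: path_filtration_def)

lemma restrict_path_space:
  assumes \<omega>: "\<omega> \<in> path_space t0 T" and t: "t \<in> {t0..T}"
  shows "restrict \<omega> {t0..t} \<in> path_space t0 t"
proof -
  have "\<forall>\<^sub>F s in at_right u. restrict \<omega> {t0..t} s = restrict \<omega> {t0..t} u" if u: "u \<in> {t0..<t}" for u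
  proof -
    have "\<forall>\<^sub>F s in at_right u. \<omega> s = \<omega> u"
      using \<omega> u t by (auto simp: path_space_def cadlag_on_def)
    moreover have "\<forall>\<^sub>F s in at_right u. s \<in> {u<..<t}"
      using u by (intro eventually_at_right_real) auto
    ultimately show ?thesis
      by eventually_elim (use u in auto)
  qed
  moreover have "\<exists>i. \<forall>\<^sub>F s in at_left u. restrict \<omega> {t0..t} s = i" if u: "u \<in> {t0<..t}" for u
  proof -
    have "\<exists>i. \<forall>\<^sub>F s in at_left u. \<omega> s = i"
      using \<omega> u t by (auto simp: path_space_def cadlag_on_def)
    then obtain i where "\<forall>\<^sub>F s in at_left u. \<omega> s = i" ..
    moreover have "\<forall>\<^sub>F s in at_left u. s \<in> {t0<..<u}"
      using u by (intro eventually_at_left_real) auto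
    ultimately have "\<forall>\<^sub>F s in at_left u. restrict \<omega> {t0..t} s = i"
      by eventually_elim (use u in auto)
    then show ?thesis ..
  qed
  ultimately show ?thesis
    by (auto simp: path_space_def cadlag_on_def)
qed

lemma path_eval_adapted:
  assumes "t \<in> {t0..T}" "q \<in> {t0..t}"
  shows "{\<omega> \<in> path_space t0 T. \<omega> q = i} \<in> sets (path_filtration t0 T t)"
proof -
  have "{\<omega> \<in> path_space t0 T. \<omega> q = i} =
      (\<lambda>\<omega>. restrict \<omega> {t0..t}) -` {\<omega> \<in> path_space t0 t. \<omega> q = i} \<inter> path_space t0 T"
    using assms restrict_path_space[OF _ assms(1)] by auto
  then show ?thesis
    unfolding path_filtration_def
    by (simp only:) (rule in_vimage_algebra[OF path_eval_measurable[OF assms(2)]])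
qed

lemma path_constant_adapted:
  assumes t: "t \<in> {t0..T}" and zp: "t0 \<le> z" "z \<le> p" "p \<le> t"
  shows "{\<omega> \<in> path_space t0 T. \<forall>s\<in>{z..p}. \<omega> s = i} \<in> sets (path_filtration t0 T t)"
proof -
  let ?R = "insert p ({z..p} \<inter> \<rat>)"
  have "{\<omega> \<in> path_space t0 T. \<forall>s\<in>{z..p}. \<omega> s = i} = (\<Inter>q\<in>?R. {\<omega> \<in> path_space t0 T. \<omega> q = i})"
  proof (intro set_eqI iffI)
    fix \<omega> assume \<omega>: "\<omega> \<in> (\<Inter>q\<in>?R. {\<omega> \<in> path_space t0 T. \<omega> q = i})"
    have "\<omega> s = i" if s: "s \<in> {z..p}" for s
    proof (cases "s = p")
      case False
      then obtain e where e: "0 < e" "s + e \<le> T" "\<And>r. s \<le> r \<Longrightarrow> r < s + e \<Longrightarrow> \<omega> r = \<omega> s"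
        using path_space_right_constant[of \<omega> t0 T s] \<omega> s t zp by auto
      obtain r where "r \<in> \<rat>" "s < r" "r < min p (s + e)"
        using Rats_dense_in_real[of s "min p (s + e)"] e(1) False s by auto
      then show ?thesis using e(3)[of r] \<omega> s by auto
    qed (use \<omega> in auto)
    then show "\<omega> \<in> {\<omega> \<in> path_space t0 T. \<forall>s\<in>{z..p}. \<omega> s = i}" using \<omega> by auto
  qed (use zp in auto)
  moreover have "(\<Inter>q\<in>?R. {\<omega> \<in> path_space t0 T. \<omega> q = i}) \<in> sets (path_filtration t0 T t)"
    using zp by (intro sets.countable_INT' image_subsetI path_eval_adapted[OF t]) (auto simp: countable_rat)
  ultimately show ?thesis by simp
qed

text \<open>
  That a hit has occurred by time \<open>t\<close> is decided by the path up to time \<open>t\<close>, without completing or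
  right-continuously enlarging the filtration. A hit may occur exactly at a jump, at an irrational time, so
  testing rational times does not suffice. However, starting from a hit the path stays in the same state
  \<open>i\<close> up to some rational \<open>p\<close> (or \<open>p = t\<close>), and then it also occupies \<open>i\<close> from the last
  time \<open>z\<close> before \<open>p\<close> that lies in the closed set \<open>Z i\<close>. Since \<open>z\<close> depends on \<open>p\<close> and \<open>i\<close> only,
  countably many events of constancy on \<open>{z..p}\<close> make up the event.
\<close>

lemma hitting_event_adapted:
  fixes Z :: "'s::finite \<Rightarrow> real set"
  assumes Z: "\<And>i. closed (Z i)" and t: "t \<in> {t0..T}"
  shows "{\<omega> \<in> path_space t0 T. \<exists>s\<in>{t0..t}. s \<in> Z (\<omega> s)} \<in> sets (path_filtration t0 T t)"
proof -
  define I where "I = {(p, i). p \<in> insert t ({t0..t} \<inter> \<rat>) \<and> Z i \<inter> {t0..p} \<noteq> {}}"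
  define z where "z = (\<lambda>(p, i). Sup (Z i \<inter> {t0..p}))"
  have z_in: "z (p, i) \<in> Z i" "t0 \<le> z (p, i)" "z (p, i) \<le> p" if "(p, i) \<in> I" for p i
  proof -
    have "z (p, i) \<in> Z i \<inter> {t0..p}"
      unfolding z_def case_prod_conv
    proof (rule closed_contains_Sup)
      show "Z i \<inter> {t0..p} \<noteq> {}" using that by (auto simp: I_def)
      show "closed (Z i \<inter> {t0..p})" using Z by (intro closed_Int) auto
    qed (auto intro!: bdd_above.I[of _ p])
    then show "z (p, i) \<in> Z i" "t0 \<le> z (p, i)" "z (p, i) \<le> p" by auto
  qed
  have z_ge: "s \<le> z (p, i)" if "s \<in> Z i" "s \<in> {t0..p}" for s p i
    unfolding z_def using that by (auto intro!: cSup_upper bdd_above.I[of _ p])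
  have p_le: "p \<le> t" "t0 \<le> p" if "(p, i) \<in> I" for p i
    using that t by (auto simp: I_def)
  let ?E = "\<lambda>(p, i). {\<omega> \<in> path_space t0 T. \<forall>s\<in>{z (p, i)..p}. \<omega> s = i}"
  have "{\<omega> \<in> path_space t0 T. \<exists>s\<in>{t0..t}. s \<in> Z (\<omega> s)} = (\<Union>x\<in>I. ?E x)"
  proof (intro set_eqI iffI)
    fix \<omega> assume "\<omega> \<in> {\<omega> \<in> path_space t0 T. \<exists>s\<in>{t0..t}. s \<in> Z (\<omega> s)}"
    then obtain s where \<omega>: "\<omega> \<in> path_space t0 T" and s: "s \<in> {t0..t}" "s \<in> Z (\<omega> s)" by blast
    obtain p where p: "p \<in> insert t ({t0..t} \<inter> \<rat>)" "s \<le> p" "\<forall>r\<in>{s..p}. \<omega> r = \<omega> s"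
    proof (cases "s = t")
      case False
      then obtain e where e: "0 < e" "s + e \<le> T" "\<And>r. s \<le> r \<Longrightarrow> r < s + e \<Longrightarrow> \<omega> r = \<omega> s"
        using path_space_right_constant[of \<omega> t0 T s] \<omega> s t by auto
      obtain p where p: "p \<in> \<rat>" "s < p" "p < min t (s + e)"
        using Rats_dense_in_real[of s "min t (s + e)"] e(1) False s by auto
      show thesis
      proof (rule that)
        show "\<forall>r\<in>{s..p}. \<omega> r = \<omega> s" using p by (intro ballI e(3)) auto
      qed (use p s(1) in auto)
    next
      case True
      then show thesis by (intro that[of t]) auto
    qed
    have "(p, \<omega> s) \<in> I" using p(1,2) s by (auto simp: I_def)
    moreover have "s \<le> z (p, \<omega> s)" using p(2) s by (intro z_ge) auto
    then have "\<forall>r\<in>{z (p, \<omega> s)..p}. \<omega> r = \<omega> s" using p(3) by (meson atLeastAtMost_iff order_trans)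
    then have "\<omega> \<in> ?E (p, \<omega> s)" using \<omega> by blast
    ultimately show "\<omega> \<in> (\<Union>x\<in>I. ?E x)" by (rule UN_I)
  next
    fix \<omega> assume "\<omega> \<in> (\<Union>x\<in>I. ?E x)"
    then obtain p i where pi: "(p, i) \<in> I" and \<omega>: "\<omega> \<in> path_space t0 T" "\<forall>s\<in>{z (p, i)..p}. \<omega> s = i"
      by auto
    have "\<omega> (z (p, i)) = i" using \<omega>(2) z_in(3)[OF pi] by auto
    then show "\<omega> \<in> {\<omega> \<in> path_space t0 T. \<exists>s\<in>{t0..t}. s \<in> Z (\<omega> s)}"
      using z_in[OF pi] p_le[OF pi] \<omega>(1) by (auto intro!: bexI[of _ "z (p, i)"])
  qed
  moreover have "(\<Union>x\<in>I. ?E x) \<in> sets (path_filtration t0 T t)"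
  proof (rule sets.countable_UN', goal_cases)
    case 1
    have "I \<subseteq> insert t \<rat> \<times> UNIV" by (auto simp: I_def)
    then show ?case
      by (rule countable_subset) (auto intro!: countable_SIGMA simp: countable_rat)
  next
    case 2
    show ?case
      using z_in p_le by (auto intro!: path_constant_adapted[OF t])
  qed
  ultimately show ?thesis by simp
qed

text \<open>
  The infimum of the hits is itself a hit: the path is constant shortly after it, so hits
  approaching it from the right lie in one closed set.
\<close>

lemma first_hit_attained:
  fixes Z :: "'s \<Rightarrow> real set"
  assumes Z: "\<And>i. closed (Z i)" and \<omega>: "\<omega> \<in> path_space t0 T" and "t0 \<le> T" and end_hit: "T \<in> Z (\<omega> T)"
  obtains m where "m \<in> {t0..T}" "m \<in> Z (\<omega> m)" "\<And>s. s \<in> {t0..T} \<Longrightarrow> s \<in> Z (\<omega> s) \<Longrightarrow> m \<le> s"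
proof -
  let ?S = "{s \<in> {t0..T}. s \<in> Z (\<omega> s)}"
  define m where "m = Inf ?S"
  have T: "T \<in> ?S" using assms by auto
  have bdd: "bdd_below ?S" by (auto intro!: bdd_below.I[of _ t0])
  have le: "m \<le> s" if "s \<in> ?S" for s
    unfolding m_def using that bdd by (intro cInf_lower)
  have m: "m \<in> {t0..T}"
    using le[OF T] T unfolding m_def by (auto intro!: cInf_greatest)
  have "m \<in> Z (\<omega> m)"
  proof (cases "m = T")
    case False
    then have "m \<in> {t0..<T}" using m by simp
    then obtain e where e: "0 < e" "m + e \<le> T" "\<And>r. m \<le> r \<Longrightarrow> r < m + e \<Longrightarrow> \<omega> r = \<omega> m"
      by (rule path_space_right_constant[OF \<omega>]) (rule that)
    have "\<exists>y\<in>Z (\<omega> m). dist y m < d" if d: "d > 0" for d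
    proof -
      have "Inf ?S < m + min d e" using d e(1) unfolding m_def by simp
      then obtain s where s: "s \<in> ?S" "s < m + min d e"
        using cInf_lessD[of ?S "m + min d e"] T by auto
      then show ?thesis using e(3)[of s] le[of s] by (intro bexI[of _ s]) (auto simp: dist_real_def)
    qed
    then show ?thesis using closed_approachable[OF Z] by blast
  qed (use end_hit in auto)
  then show thesis using m le by (intro that) auto
qed

text \<open>
  The state at time \<open>s\<close> is the value taken at all rational times shortly after \<open>s\<close>.
\<close>

lemma path_eval_jointly_measurable:
  "(\<lambda>(s, \<omega>). \<omega> s) \<in> restrict_space borel {t0..T} \<Otimes>\<^sub>M path_borel t0 T \<rightarrow>\<^sub>M count_space (UNIV :: 's::finite set)"
proof (rule measurable_count_space_eq2[THEN iffD2], simp, intro conjI ballI funcsetI UNIV_I)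
  let ?M = "restrict_space borel {t0..T} \<Otimes>\<^sub>M path_borel t0 T"
  fix i :: 's
  have sp: "space ?M = {t0..T} \<times> path_space t0 T"
    by (simp add: space_pair_measure space_restrict_space)
  have ev: "Measurable.pred ?M (\<lambda>x. snd x q = i)" if "q \<in> {t0..T}" for q
  proof -
    have "Measurable.pred (path_borel t0 T) (\<lambda>\<omega>. \<omega> q = i)"
      unfolding pred_def using path_eval_measurable[OF that] by simp
    from measurable_compose[OF measurable_snd this] show ?thesis .
  qed
  have [measurable]: "(\<lambda>x. fst x) \<in> borel_measurable ?M"
    by (rule measurable_compose[OF measurable_fst measurable_restrict_space1]) simp
  define C where "C p q x \<longleftrightarrow> (of_rat q \<in> {t0..T} \<longrightarrow> fst x < of_rat q \<longrightarrow>
      of_rat q < (of_rat p :: real) \<longrightarrow> snd x (of_rat q) = i)" for p q :: rat and x :: "real \<times> (real \<Rightarrow> 's)"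
  have "Measurable.pred ?M (C p q)" for p q
    using ev[of "of_rat q"] unfolding C_def by (cases "(of_rat q :: real) \<in> {t0..T}") auto
  then have C: "Measurable.pred ?M (\<lambda>x. \<forall>q. C p q x)" for p
    by (rule pred_intros_countable)
  define E where "E x \<longleftrightarrow> (t0 \<le> T \<longrightarrow> snd x T = i)" for x :: "real \<times> (real \<Rightarrow> 's)"
  have [measurable]: "Measurable.pred ?M E"
    using ev[of T] unfolding E_def by (cases "t0 \<le> T") auto
  have "Measurable.pred ?M (\<lambda>x. fst x < of_rat p \<and> (of_rat p::real) \<le> T \<and> (\<forall>q. C p q x))" for p
    by (intro pred_intros_logic C) measurable
  then have ex: "Measurable.pred ?M (\<lambda>x. \<exists>p. fst x < of_rat p \<and> (of_rat p::real) \<le> T \<and> (\<forall>q. C p q x))"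
    by (rule pred_intros_countable)
  define G where "G x \<longleftrightarrow> (\<exists>p. fst x < of_rat p \<and> (of_rat p::real) \<le> T \<and> (\<forall>q. C p q x))" for x
  have [measurable]: "Measurable.pred ?M G"
    using ex unfolding G_def .
  \<comment> \<open>The final time has no times after it, hence the separate disjunct.\<close>
  let ?P = "\<lambda>x. (fst x = T \<and> E x) \<or> G x"
  have "Measurable.pred ?M ?P"
    by measurable
  moreover have "(\<lambda>(s, \<omega>). \<omega> s) -` {i} \<inter> space ?M = {x \<in> space ?M. ?P x}"
  proof (intro set_eqI iffI)
    fix x assume "x \<in> (\<lambda>(s, \<omega>). \<omega> s) -` {i} \<inter> space ?M"
    then obtain s \<omega> where x: "x = (s, \<omega>)" "\<omega> s = i" "s \<in> {t0..T}" "\<omega> \<in> path_space t0 T" by (auto simp: sp)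
    have "?P x"
    proof (cases "s = T")
      case False
      then obtain e where e: "0 < e" "s + e \<le> T" "\<And>r. s \<le> r \<Longrightarrow> r < s + e \<Longrightarrow> \<omega> r = \<omega> s"
        using path_space_right_constant[of \<omega> t0 T s] x by auto
      obtain p where p: "s < of_rat p" "of_rat p < s + e"
        using of_rat_dense[of s "s + e"] e(1) by auto
      have "\<omega> (of_rat q) = i" if "s < of_rat q" "of_rat q < (of_rat p :: real)" for q
        using e(3)[of "of_rat q"] p that x(2) by simp
      then show ?thesis using p e(2) x(1) by (auto simp: G_def C_def intro!: exI[of _ p])
    qed (use x in \<open>auto simp: E_def\<close>)
    then show "x \<in> {x \<in> space ?M. ?P x}" using x by (simp add: sp)
  next
    fix x assume "x \<in> {x \<in> space ?M. ?P x}"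
    then obtain s \<omega> where x: "x = (s, \<omega>)" "?P (s, \<omega>)" "s \<in> {t0..T}" "\<omega> \<in> path_space t0 T" by (auto simp: sp)
    have "\<omega> s = i"
    proof (cases "s = T")
      case False
      then obtain e where e: "0 < e" "s + e \<le> T" "\<And>r. s \<le> r \<Longrightarrow> r < s + e \<Longrightarrow> \<omega> r = \<omega> s"
        using path_space_right_constant[of \<omega> t0 T s] x by auto
      from x(2) False obtain p :: rat where p: "s < of_rat p" "of_rat p \<le> T"
        "\<And>q. of_rat q \<in> {t0..T} \<Longrightarrow> s < of_rat q \<Longrightarrow> of_rat q < (of_rat p :: real) \<Longrightarrow> \<omega> (of_rat q) = i"
        by (auto simp: C_def G_def)
      obtain q where q: "s < of_rat q" "of_rat q < min (of_rat p) (s + e)"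
        using of_rat_dense[of s "min (of_rat p) (s + e)"] e(1) p(1) by auto
      then show ?thesis using e(3)[of "of_rat q"] p(2) p(3)[of q] x(3) by auto
    qed (use x in \<open>auto simp: E_def G_def\<close>)
    then show "x \<in> (\<lambda>(s, \<omega>). \<omega> s) -` {i} \<inter> space ?M" using x by (simp add: sp)
  qed
  ultimately show "(\<lambda>(s, \<omega>). \<omega> s) -` {i} \<inter> space ?M \<in> sets ?M"
    unfolding pred_def by simp
qed

text \<open>
  The Borel sets of a product of general topological spaces need not be generated by measurable
  rectangles, so measurability of \<open>X\<close> and \<open>Y\<close> does not give measurability of the pair. Compactness
  replaces a countable base: for each \<open>n\<close> finitely many open boxes on which \<open>f\<close> varies by less than
  \<open>e n\<close> cover the domain, and preimages of boxes are measurable.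
\<close>

lemma borel_measurable_compose_compact:
  fixes f :: "'a::topological_space \<Rightarrow> 'u::topological_space \<Rightarrow> 'v::topological_space \<Rightarrow> real"
  assumes comp: "compact A" "compact U" "compact V"
    and f: "continuous_on (A \<times> U \<times> V) (\<lambda>(t, u, v). f t u v)"
    and S: "S \<in> M \<rightarrow>\<^sub>M restrict_space borel A" and X: "X \<in> M \<rightarrow>\<^sub>M restrict_space borel U"
    and Y: "Y \<in> M \<rightarrow>\<^sub>M restrict_space borel V"
  shows "(\<lambda>m. f (S m) (X m) (Y m)) \<in> borel_measurable M"
proof -
  let ?K = "A \<times> U \<times> V" and ?F = "\<lambda>(t, u, v). f t u v"
  have in_K: "(S m, X m, Y m) \<in> ?K" if "m \<in> space M" for m
    using measurable_space[OF S that] measurable_space[OF X that] measurable_space[OF Y that]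
    by (auto simp: space_restrict_space)
  have K: "compact ?K" using comp by (intro compact_Times)
  have box: "\<exists>a b c. open a \<and> open b \<and> open c \<and> z \<in> a \<times> b \<times> c \<and>
      (\<forall>w\<in>a \<times> b \<times> c \<inter> ?K. \<bar>?F w - ?F z\<bar> < e)" if z: "z \<in> ?K" and e: "e > 0" for z e
  proof -
    obtain G where G: "open G" "G \<inter> ?K = ?F -` ball (?F z) e \<inter> ?K"
      using f unfolding continuous_on_open_invariant by (meson open_ball)
    have "z \<in> G" using G(2) z e by auto
    from open_prod_elim[OF G(1) this] obtain a B where aB: "open a" "open B" "z \<in> a \<times> B" "a \<times> B \<subseteq> G" by metis
    then have "snd z \<in> B" by auto
    from open_prod_elim[OF aB(2) this] obtain b c where bc: "open b" "open c" "snd z \<in> b \<times> c" "b \<times> c \<subseteq> B" by metis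
    have "a \<times> b \<times> c \<subseteq> G" using bc(4) aB(4) by blast
    then have "a \<times> b \<times> c \<inter> ?K \<subseteq> ?F -` ball (?F z) e" using G(2) by blast
    then have "\<forall>w\<in>a \<times> b \<times> c \<inter> ?K. \<bar>?F w - ?F z\<bar> < e"
      by (auto simp: dist_real_def abs_minus_commute subset_iff)
    moreover have "z \<in> a \<times> b \<times> c" using aB(3) bc(3) by (cases z) auto
    ultimately show ?thesis using aB bc by blast
  qed
  define e where "e n = 1 / real (Suc n)" for n
  have e: "e n > 0" for n by (simp add: e_def)
  define good where "good n z = (\<lambda>(a, b, c). open a \<and> open b \<and> open c \<and> z \<in> a \<times> b \<times> c \<and>
      (\<forall>w\<in>a \<times> b \<times> c \<inter> ?K. \<bar>?F w - ?F z\<bar> < e n))" for n z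
  define p where "p n z = (SOME p. good n z p)" for n z
  define a where "a n z = fst (p n z)" for n z
  define b where "b n z = fst (snd (p n z))" for n z
  define c where "c n z = snd (snd (p n z))" for n z
  have abc: "open (a n z) \<and> open (b n z) \<and> open (c n z) \<and>
      z \<in> a n z \<times> b n z \<times> c n z \<and> (\<forall>w\<in>a n z \<times> b n z \<times> c n z \<inter> ?K. \<bar>?F w - ?F z\<bar> < e n)"
    if z: "z \<in> ?K" for n z
  proof -
    obtain a' b' c' where "open a' \<and> open b' \<and> open c' \<and> z \<in> a' \<times> b' \<times> c' \<and>
      (\<forall>w\<in>a' \<times> b' \<times> c' \<inter> ?K. \<bar>?F w - ?F z\<bar> < e n)"
      using box[OF z e, of n] by blast
    then have "good n z (a', b', c')" unfolding good_def case_prod_conv .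
    then have "good n z (p n z)" unfolding p_def by (rule someI)
    moreover obtain a1 b1 c1 where p: "p n z = (a1, b1, c1)" by (cases "p n z")
    moreover have "a n z = a1" "b n z = b1" "c n z = c1" by (simp_all add: a_def b_def c_def p)
    ultimately show ?thesis unfolding good_def by simp
  qed
  have "\<forall>n. \<exists>C. C \<subseteq> ?K \<and> finite C \<and> ?K \<subseteq> (\<Union>z\<in>C. a n z \<times> b n z \<times> c n z)"
  proof (rule allI)
    fix n
    show "\<exists>C. C \<subseteq> ?K \<and> finite C \<and> ?K \<subseteq> (\<Union>z\<in>C. a n z \<times> b n z \<times> c n z)"
    proof (rule compactE_image[OF K])
      show "open (a n z \<times> b n z \<times> c n z)" if "z \<in> ?K" for z
        using abc[OF that] by (intro open_Times) auto
      show "?K \<subseteq> (\<Union>z\<in>?K. a n z \<times> b n z \<times> c n z)" using abc by blast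
    qed blast
  qed
  from choice[OF this] obtain C where
    C: "\<And>n. C n \<subseteq> ?K" "\<And>n. finite (C n)" "\<And>n. ?K \<subseteq> (\<Union>z\<in>C n. a n z \<times> b n z \<times> c n z)"
    by blast
  have near: "\<bar>f (S m) (X m) (Y m) - ?F z\<bar> < e n"
    if "z \<in> C n" "m \<in> space M" "S m \<in> a n z" "X m \<in> b n z" "Y m \<in> c n z" for m n z
  proof -
    have "z \<in> ?K" using that(1) C(1) by blast
    from abc[OF this] have *: "\<forall>w\<in>a n z \<times> b n z \<times> c n z \<inter> ?K. \<bar>?F w - ?F z\<bar> < e n" by blast
    have "(S m, X m, Y m) \<in> a n z \<times> b n z \<times> c n z \<inter> ?K" using in_K that by blast
    from bspec[OF * this] show ?thesis by simp
  qed
  define W where "W n z = {m \<in> space M. S m \<in> a n z \<and> X m \<in> b n z \<and> Y m \<in> c n z}" for n z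
  have W: "W n z \<in> sets M" if "z \<in> ?K" for n z
  proof -
    have "S -` a n z \<inter> space M \<in> sets M" "X -` b n z \<inter> space M \<in> sets M" "Y -` c n z \<inter> space M \<in> sets M"
      using measurable_restrict_space2_iff[THEN iffD1, OF S] measurable_restrict_space2_iff[THEN iffD1, OF X]
        measurable_restrict_space2_iff[THEN iffD1, OF Y] abc[OF that]
      by (auto intro!: measurable_sets[where A = borel])
    moreover have "W n z = (S -` a n z \<inter> space M) \<inter> ((X -` b n z \<inter> space M) \<inter> (Y -` c n z \<inter> space M))"
      by (auto simp: W_def)
    ultimately show ?thesis by simp
  qed
  show ?thesis
  proof (rule borel_measurable_iff_greater[THEN iffD2], rule allI)
    fix r
    have "{m \<in> space M. r < f (S m) (X m) (Y m)} = (\<Union>n. \<Union>z\<in>{z \<in> C n. r + e n \<le> ?F z}. W n z)"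
    proof (intro set_eqI iffI)
      fix m assume "m \<in> {m \<in> space M. r < f (S m) (X m) (Y m)}"
      then have m: "m \<in> space M" "r < f (S m) (X m) (Y m)" by auto
      obtain n where n: "e n < (f (S m) (X m) (Y m) - r) / 2"
        using m(2) nat_approx_posE[of "(f (S m) (X m) (Y m) - r) / 2"] by (auto simp: e_def)
      obtain z where z: "z \<in> C n" "(S m, X m, Y m) \<in> a n z \<times> b n z \<times> c n z"
        using C(3)[of n] in_K[OF m(1)] by blast
      then have "\<bar>f (S m) (X m) (Y m) - ?F z\<bar> < e n"
        using m(1) by (intro near) auto
      then have "r + e n \<le> ?F z" using n by (simp add: field_simps abs_less_iff)
      then show "m \<in> (\<Union>n. \<Union>z\<in>{z \<in> C n. r + e n \<le> ?F z}. W n z)"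
        using z m(1) by (intro UN_I[of n] UN_I[of z]) (auto simp: W_def)
    next
      fix m assume "m \<in> (\<Union>n. \<Union>z\<in>{z \<in> C n. r + e n \<le> ?F z}. W n z)"
      then obtain n z where z: "z \<in> C n" "r + e n \<le> ?F z" "m \<in> W n z" by blast
      then have m: "m \<in> space M" "(S m, X m, Y m) \<in> a n z \<times> b n z \<times> c n z" by (auto simp: W_def)
      then have "\<bar>f (S m) (X m) (Y m) - ?F z\<bar> < e n"
        using z(1) by (intro near) auto
      then have "r < f (S m) (X m) (Y m)" using z(2) by (simp add: abs_less_iff)
      then show "m \<in> {m \<in> space M. r < f (S m) (X m) (Y m)}" using m(1) by simp
    qed
    also have "\<dots> \<in> sets M"
    proof (intro sets.countable_UN image_subsetI sets.finite_UN)
      show "W n z \<in> sets M" if "z \<in> {z \<in> C n. r + e n \<le> ?F z}" for n z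
        using that C(1)[of n] by (intro W) blast
    qed (use C(2) in simp)
    finally show "{m \<in> space M. r < f (S m) (X m) (Y m)} \<in> sets M" .
  qed
qed

section \<open>Optional stopping\<close>

text \<open>
  On each event \<open>\<sigma> = a\<close>, which is known at time \<open>a\<close>, the values of the process at the times \<open>a\<close> and
  \<open>u\<close> have the same integral.
\<close>

lemma optional_stopping_finite:
  fixes X :: "real \<Rightarrow> 'w \<Rightarrow> real"
  assumes P: "prob_space P" and M: "martingale_on P F I X"
    and A: "finite A" "A \<subseteq> I" and u: "u \<in> I" "\<And>a. a \<in> A \<Longrightarrow> a \<le> u"
    and \<sigma>: "\<And>\<omega>. \<omega> \<in> space P \<Longrightarrow> \<sigma> \<omega> \<in> A"
    and stop: "\<And>a. a \<in> A \<Longrightarrow> {\<omega> \<in> space P. \<sigma> \<omega> = a} \<in> sets (F a)"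
  shows "integrable P (\<lambda>\<omega>. X (\<sigma> \<omega>) \<omega>)" and "(\<integral>\<omega>. X (\<sigma> \<omega>) \<omega> \<partial>P) = (\<integral>\<omega>. X u \<omega> \<partial>P)"
proof -
  interpret prob_space P by fact
  define B where "B a = {\<omega> \<in> space P. \<sigma> \<omega> = a}" for a
  have sub: "subalgebra P (F a)" if "a \<in> I" for a
    using M that by (simp add: martingale_on_def)
  have Xint: "integrable P (X a)" if "a \<in> I" for a
    using M that by (simp add: martingale_on_def)
  have BF: "B a \<in> sets (F a)" if "a \<in> A" for a
    using stop[OF that] by (simp add: B_def)
  have BP: "B a \<in> sets P" if "a \<in> A" for a
    using BF[OF that] sub[of a] A that by (auto simp: subalgebra_def)
  have split: "Y (\<sigma> \<omega>) \<omega> = (\<Sum>a\<in>A. indicator (B a) \<omega> * Y a \<omega>)"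
    if "\<omega> \<in> space P" for Y :: "real \<Rightarrow> 'w \<Rightarrow> real" and \<omega>
  proof -
    have "(\<Sum>a\<in>A. indicator (B a) \<omega> * Y a \<omega>) = (\<Sum>a\<in>A. if a = \<sigma> \<omega> then Y a \<omega> else 0)"
      using that by (intro sum.cong) (auto simp: B_def)
    then show ?thesis using A(1) \<sigma>[OF that] by simp
  qed
  have int: "integrable P (\<lambda>\<omega>. indicator (B a) \<omega> * X b \<omega>)" if "a \<in> A" "b \<in> I" for a b
    using integrable_mult_indicator[OF BP[OF that(1)] Xint[OF that(2)]] by simp
  have eq: "(\<integral>\<omega>. indicator (B a) \<omega> * X a \<omega> \<partial>P) = (\<integral>\<omega>. indicator (B a) \<omega> * X u \<omega> \<partial>P)" if a: "a \<in> A" for a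
  proof -
    have aI: "a \<in> I" using a A by auto
    interpret S: finite_measure_subalgebra P "F a"
      by unfold_locales (rule sub[OF aI])
    have ce: "AE \<omega> in P. real_cond_exp P (F a) (X u) \<omega> = X a \<omega>"
      using M aI u a by (simp add: martingale_on_def)
    have "(\<integral>\<omega>\<in>B a. X u \<omega> \<partial>P) = (\<integral>\<omega>\<in>B a. real_cond_exp P (F a) (X u) \<omega> \<partial>P)"
      by (rule S.real_cond_exp_intA[OF Xint[OF u(1)] BF[OF a]])
    also have "\<dots> = (\<integral>\<omega>\<in>B a. X a \<omega> \<partial>P)"
      unfolding set_lebesgue_integral_def
    proof (rule integral_cong_AE)
      show "AE \<omega> in P. indicat_real (B a) \<omega> *\<^sub>R real_cond_exp P (F a) (X u) \<omega> = indicat_real (B a) \<omega> *\<^sub>R X a \<omega>"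
        using ce by eventually_elim simp
      show "(\<lambda>\<omega>. indicat_real (B a) \<omega> *\<^sub>R X a \<omega>) \<in> borel_measurable P"
        using int[OF a aI] by (auto dest: borel_measurable_integrable)
      show "(\<lambda>\<omega>. indicat_real (B a) \<omega> *\<^sub>R real_cond_exp P (F a) (X u) \<omega>) \<in> borel_measurable P"
        using BP[OF a] by (intro borel_measurable_scaleR borel_measurable_indicator borel_measurable_cond_exp2)
    qed
    finally show ?thesis by (simp add: set_lebesgue_integral_def)
  qed
  have "integrable P (\<lambda>\<omega>. \<Sum>a\<in>A. indicator (B a) \<omega> * X a \<omega>)"
    using int A by (intro Bochner_Integration.integrable_sum) auto
  moreover have "integrable P (\<lambda>\<omega>. X (\<sigma> \<omega>) \<omega>) \<longleftrightarrow>
      integrable P (\<lambda>\<omega>. \<Sum>a\<in>A. indicator (B a) \<omega> * X a \<omega>)"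
    by (rule Bochner_Integration.integrable_cong[OF refl]) (rule split[of _ X])
  ultimately show "integrable P (\<lambda>\<omega>. X (\<sigma> \<omega>) \<omega>)" by simp
  have "(\<integral>\<omega>. X (\<sigma> \<omega>) \<omega> \<partial>P) = (\<integral>\<omega>. (\<Sum>a\<in>A. indicator (B a) \<omega> * X a \<omega>) \<partial>P)"
    by (rule Bochner_Integration.integral_cong[OF refl]) (rule split[of _ X])
  also have "\<dots> = (\<Sum>a\<in>A. \<integral>\<omega>. indicator (B a) \<omega> * X a \<omega> \<partial>P)"
    using int A by (intro Bochner_Integration.integral_sum) auto
  also have "\<dots> = (\<Sum>a\<in>A. \<integral>\<omega>. indicator (B a) \<omega> * X u \<omega> \<partial>P)"
    using eq by simp
  also have "\<dots> = (\<integral>\<omega>. (\<Sum>a\<in>A. indicator (B a) \<omega> * X u \<omega>) \<partial>P)"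
    using int u by (intro Bochner_Integration.integral_sum[symmetric]) auto
  also have "\<dots> = (\<integral>\<omega>. X u \<omega> \<partial>P)"
    by (rule Bochner_Integration.integral_cong[OF refl]) (rule split[of _ "\<lambda>_. X u", symmetric])
  finally show "(\<integral>\<omega>. X (\<sigma> \<omega>) \<omega> \<partial>P) = (\<integral>\<omega>. X u \<omega> \<partial>P)" .
qed

text \<open>
  Rounds \<open>x\<close> up to the grid of mesh \<open>1 / (n + 1)\<close> starting in \<open>t0\<close>, cut off at \<open>T\<close>. A grid of fixed mesh,
  rather than a subdivision of \<open>{t0..T}\<close>, also covers the case \<open>t0 = T\<close>.
\<close>

definition grid_above :: "real \<Rightarrow> real \<Rightarrow> nat \<Rightarrow> real \<Rightarrow> real" where
  "grid_above t0 T n x = min T (t0 + of_int \<lceil>(x - t0) * real (Suc n)\<rceil> / real (Suc n))"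

lemma grid_above_bounds:
  assumes "x \<le> T"
  shows "x \<le> grid_above t0 T n x" "grid_above t0 T n x \<le> x + 1 / real (Suc n)" "grid_above t0 T n x \<le> T"
proof -
  let ?N = "real (Suc n)"
  have N: "?N > 0" by simp
  have "(x - t0) * ?N \<le> of_int \<lceil>(x - t0) * ?N\<rceil>" by (rule le_of_int_ceiling)
  then have "x - t0 \<le> of_int \<lceil>(x - t0) * ?N\<rceil> / ?N" using N by (simp only: pos_le_divide_eq)
  then show "x \<le> grid_above t0 T n x" using assms by (simp add: grid_above_def)
  have "of_int \<lceil>(x - t0) * ?N\<rceil> \<le> (x - t0) * ?N + 1" by (rule of_int_ceiling_le_add_one)
  then have "of_int \<lceil>(x - t0) * ?N\<rceil> / ?N \<le> ((x - t0) * ?N + 1) / ?N" using N by (simp only: divide_le_cancel) simp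
  also have "\<dots> = x - t0 + 1 / ?N" using N by (simp add: field_simps del: of_nat_Suc)
  finally show "grid_above t0 T n x \<le> x + 1 / ?N" by (simp add: grid_above_def del: of_nat_Suc)
qed (simp add: grid_above_def)

lemma finite_range_grid_above: "finite (grid_above t0 T n ` {t0..T})"
proof (rule finite_subset)
  show "grid_above t0 T n ` {t0..T} \<subseteq>
      (\<lambda>k. min T (t0 + of_int k / real (Suc n))) ` {0..\<lceil>(T - t0) * real (Suc n)\<rceil>}"
  proof (rule image_subsetI)
    fix x assume x: "x \<in> {t0..T}"
    have "(x - t0) * real (Suc n) \<le> (T - t0) * real (Suc n)" using x by (intro mult_right_mono) auto
    then have "\<lceil>(x - t0) * real (Suc n)\<rceil> \<le> \<lceil>(T - t0) * real (Suc n)\<rceil>" by (rule ceiling_mono)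
    moreover have "0 \<le> (x - t0) * real (Suc n)" using x by simp
    then have "0 \<le> \<lceil>(x - t0) * real (Suc n)\<rceil>" by linarith
    ultimately show "grid_above t0 T n x \<in>
      (\<lambda>k. min T (t0 + of_int k / real (Suc n))) ` {0..\<lceil>(T - t0) * real (Suc n)\<rceil>}"
      unfolding grid_above_def by (intro imageI) simp
  qed
qed simp

text \<open>
  Stopping times with finitely many values approach \<open>\<tau>\<close> from the right, and the process is bounded
  and right-continuous, so the finite case passes to the limit.
\<close>

lemma optional_stopping:
  fixes X :: "real \<Rightarrow> 'w \<Rightarrow> real"
  assumes P: "prob_space P" and M: "martingale_on P F {t0..T} X" and t0T: "t0 \<le> T"
    and \<tau>: "\<And>\<omega>. \<omega> \<in> space P \<Longrightarrow> \<tau> \<omega> \<in> {t0..T}"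
    and stop: "\<And>t. t \<in> {t0..T} \<Longrightarrow> {\<omega> \<in> space P. \<tau> \<omega> \<le> t} \<in> sets (F t)"
    and right: "\<And>\<omega> s. \<omega> \<in> space P \<Longrightarrow> s \<in> {t0..T} \<Longrightarrow> continuous (at s within {s..T}) (\<lambda>r. X r \<omega>)"
    and bound: "\<And>\<omega> s. \<omega> \<in> space P \<Longrightarrow> s \<in> {t0..T} \<Longrightarrow> \<bar>X s \<omega>\<bar> \<le> K"
  shows "integrable P (\<lambda>\<omega>. X (\<tau> \<omega>) \<omega>)" and "(\<integral>\<omega>. X (\<tau> \<omega>) \<omega> \<partial>P) = (\<integral>\<omega>. X T \<omega> \<partial>P)"
proof -
  interpret prob_space P by fact
  define \<sigma> where "\<sigma> n \<omega> = grid_above t0 T n (\<tau> \<omega>)" for n \<omega>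
  have \<sigma>_ge: "\<tau> \<omega> \<le> \<sigma> n \<omega>" and \<sigma>_le: "\<sigma> n \<omega> \<le> \<tau> \<omega> + 1 / real (Suc n)" and \<sigma>T: "\<sigma> n \<omega> \<le> T"
    if "\<omega> \<in> space P" for n \<omega>
    using grid_above_bounds[of "\<tau> \<omega>" T t0 n] \<tau>[OF that] by (auto simp: \<sigma>_def)
  have spF: "space (F a) = space P" and monoF: "r \<le> a \<Longrightarrow> r \<in> {t0..T} \<Longrightarrow> sets (F r) \<subseteq> sets (F a)"
    if "a \<in> {t0..T}" for a r
    using M that unfolding martingale_on_def subalgebra_def by blast+
  have min_meas: "(\<lambda>\<omega>. min a (\<tau> \<omega>)) \<in> borel_measurable (F a)" if a: "a \<in> {t0..T}" for a
  proof (rule borel_measurable_iff_le[THEN iffD2], rule allI)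
    fix r
    consider "a \<le> r" | "r < t0" | "t0 \<le> r" "r < a" by linarith
    then show "{\<omega> \<in> space (F a). min a (\<tau> \<omega>) \<le> r} \<in> sets (F a)"
    proof cases
      case 1
      then have "{\<omega> \<in> space (F a). min a (\<tau> \<omega>) \<le> r} = space (F a)" by auto
      then show ?thesis by simp
    next
      case 2
      then have "{\<omega> \<in> space (F a). min a (\<tau> \<omega>) \<le> r} = {}" using \<tau> a by (force simp: spF[OF a])
      then show ?thesis by (simp only: sets.empty_sets)
    next
      case 3
      then have "{\<omega> \<in> space (F a). min a (\<tau> \<omega>) \<le> r} = {\<omega> \<in> space P. \<tau> \<omega> \<le> r}" by (auto simp: spF[OF a])
      then show ?thesis using stop[of r] monoF[OF a, of r] 3 a by auto
    qed
  qed
  have grid_meas: "grid_above t0 T n \<in> borel_measurable borel" for n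
    unfolding grid_above_def by measurable
  let ?A = "\<lambda>n. grid_above t0 T n ` {t0..T}"
  have A: "?A n \<subseteq> {t0..T}" for n
    using grid_above_bounds(1,3)[of _ T t0 n] by (force intro: order_trans)
  \<comment> \<open>The rounded time equals \<open>a\<close> only if \<open>\<tau> \<le> a\<close>, and then it is determined by \<open>min a \<tau>\<close>, which is known at time \<open>a\<close>.\<close>
  have stop_\<sigma>: "{\<omega> \<in> space P. \<sigma> n \<omega> = a} \<in> sets (F a)" if "a \<in> ?A n" for n a
  proof -
    have a: "a \<in> {t0..T}" using A that by blast
    have [measurable]: "(\<lambda>\<omega>. min a (\<tau> \<omega>)) \<in> borel_measurable (F a)" by (rule min_meas[OF a])
    note grid_meas[measurable]
    have "{\<omega> \<in> space (F a). grid_above t0 T n (min a (\<tau> \<omega>)) = a} \<in> sets (F a)" by measurable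
    then have "{\<omega> \<in> space P. \<tau> \<omega> \<le> a} \<inter> {\<omega> \<in> space (F a). grid_above t0 T n (min a (\<tau> \<omega>)) = a} \<in> sets (F a)"
      using stop[OF a] by (intro sets.Int)
    moreover have "{\<omega> \<in> space P. \<sigma> n \<omega> = a} =
        {\<omega> \<in> space P. \<tau> \<omega> \<le> a} \<inter> {\<omega> \<in> space (F a). grid_above t0 T n (min a (\<tau> \<omega>)) = a}"
      using \<sigma>_ge[of _ n] by (auto simp: spF[OF a] \<sigma>_def min_absorb2)
    ultimately show ?thesis by simp
  qed
  have T: "T \<in> {t0..T}" using t0T by simp
  have \<sigma>_stop: "integrable P (\<lambda>\<omega>. X (\<sigma> n \<omega>) \<omega>)"
    "(\<integral>\<omega>. X (\<sigma> n \<omega>) \<omega> \<partial>P) = (\<integral>\<omega>. X T \<omega> \<partial>P)" for n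
  proof -
    have in_A: "\<sigma> n \<omega> \<in> ?A n" if "\<omega> \<in> space P" for \<omega>
      using \<tau>[OF that] by (simp add: \<sigma>_def)
    have le: "a \<le> T" if "a \<in> ?A n" for a using subsetD[OF A that] by simp
    note * = optional_stopping_finite[OF P M finite_range_grid_above A T le in_A stop_\<sigma>]
    show "integrable P (\<lambda>\<omega>. X (\<sigma> n \<omega>) \<omega>)" by (rule *)
    show "(\<integral>\<omega>. X (\<sigma> n \<omega>) \<omega> \<partial>P) = (\<integral>\<omega>. X T \<omega> \<partial>P)" by (rule *)
  qed
  have lim: "(\<lambda>n. X (\<sigma> n \<omega>) \<omega>) \<longlonglongrightarrow> X (\<tau> \<omega>) \<omega>" if \<omega>: "\<omega> \<in> space P" for \<omega>
  proof (rule continuous_within_tendsto_compose'[OF right[OF \<omega> \<tau>[OF \<omega>]]])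
    show "\<sigma> n \<omega> \<in> {\<tau> \<omega>..T}" for n using \<sigma>_ge[OF \<omega>] \<sigma>T[OF \<omega>] by simp
    have "(\<lambda>n. \<tau> \<omega> + 1 / real (Suc n)) \<longlonglongrightarrow> \<tau> \<omega> + 0"
      using LIMSEQ_inverse_real_of_nat by (intro tendsto_add tendsto_const) (simp add: inverse_eq_divide)
    then show "(\<lambda>n. \<sigma> n \<omega>) \<longlonglongrightarrow> \<tau> \<omega>"
      using \<sigma>_ge[OF \<omega>] \<sigma>_le[OF \<omega>]
      by (intro tendsto_sandwich[of "\<lambda>_. \<tau> \<omega>" "\<lambda>n. \<sigma> n \<omega>" _ "\<lambda>n. \<tau> \<omega> + 1 / real (Suc n)"]) auto
  qed
  have meas: "(\<lambda>\<omega>. X (\<tau> \<omega>) \<omega>) \<in> borel_measurable P"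
    by (rule borel_measurable_LIMSEQ_real[OF lim borel_measurable_integrable[OF \<sigma>_stop(1)]])
  have bd: "AE \<omega> in P. norm (X (\<sigma> n \<omega>) \<omega>) \<le> K" for n
    using bound \<tau> \<sigma>_ge[of _ n] \<sigma>T[of _ n] by (intro AE_I2) (force intro: order_trans)
  have K: "integrable P (\<lambda>_. K)" by simp
  have "AE \<omega> in P. (\<lambda>n. X (\<sigma> n \<omega>) \<omega>) \<longlonglongrightarrow> X (\<tau> \<omega>) \<omega>"
    using lim by (intro AE_I2)
  note conv = meas borel_measurable_integrable[OF \<sigma>_stop(1)] K this bd
  show "integrable P (\<lambda>\<omega>. X (\<tau> \<omega>) \<omega>)"
    by (rule integrable_dominated_convergence[OF conv])
  have "(\<lambda>n. \<integral>\<omega>. X (\<sigma> n \<omega>) \<omega> \<partial>P) \<longlonglongrightarrow> (\<integral>\<omega>. X (\<tau> \<omega>) \<omega> \<partial>P)"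
    by (rule integral_dominated_convergence[OF conv])
  then show "(\<integral>\<omega>. X (\<tau> \<omega>) \<omega> \<partial>P) = (\<integral>\<omega>. X T \<omega> \<partial>P)"
    unfolding \<sigma>_stop(2) by (simp add: LIMSEQ_const_iff)
qed

section \<open>The play against the feedback strategy\<close>

text \<open>
  Gives the Lebesgue integrability of the running terms together with bounds that do not depend on
  the path, as needed for optional stopping.
\<close>

lemma dominated_set_integral:
  fixes f w :: "real \<Rightarrow> real"
  assumes w: "integrable lebesgue w"
    and f: "(\<lambda>s. indicator {a..b} s * f s) \<in> borel_measurable lebesgue"
    and le: "AE s in lebesgue. s \<in> {a..b} \<longrightarrow> \<bar>f s\<bar> \<le> w s"
  shows "set_integrable lebesgue {a..b} f"
    and "t \<in> {a..b} \<Longrightarrow> \<bar>LINT s:{a..t}|lebesgue. f s\<bar> \<le> (LINT s|lebesgue. \<bar>w s\<bar>)"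
proof -
  show int: "set_integrable lebesgue {a..b} f"
    unfolding set_integrable_def real_scaleR_def
  proof (rule Bochner_Integration.integrable_bound[OF w f])
    show "AE s in lebesgue. norm (indicator {a..b} s * f s) \<le> norm (w s)"
      using le by eventually_elim (auto simp: indicator_def)
  qed
  assume t: "t \<in> {a..b}"
  have "set_integrable lebesgue {a..t} f"
    using int by (rule set_integrable_subset) (use t in auto)
  then have int': "integrable lebesgue (\<lambda>s. indicator {a..t} s *\<^sub>R f s)"
    by (simp add: set_integrable_def)
  have "norm (LINT s:{a..t}|lebesgue. f s) \<le> (LINT s|lebesgue. norm (indicator {a..t} s *\<^sub>R f s))"
    unfolding set_lebesgue_integral_def by (rule integral_norm_bound)
  also have "\<dots> \<le> (LINT s|lebesgue. \<bar>w s\<bar>)"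
  proof (rule integral_mono_AE)
    show "AE s in lebesgue. norm (indicator {a..t} s *\<^sub>R f s) \<le> \<bar>w s\<bar>"
      using le by eventually_elim (use t in \<open>auto simp: indicator_def\<close>)
  qed (use int' w in auto)
  finally show "\<bar>LINT s:{a..t}|lebesgue. f s\<bar> \<le> (LINT s|lebesgue. \<bar>w s\<bar>)" by simp
qed

lemma borel_measurable_on_interval:
  fixes f :: "real \<Rightarrow> real"
  assumes "f \<in> borel_measurable (restrict_space borel {a..b})"
  shows "(\<lambda>s. indicator {a..b} s * f s) \<in> borel_measurable borel"
  using assms by (subst (asm) borel_measurable_restrict_space_iff) auto

text \<open>
  What is needed to stop the Dynkin process at the contact time. The obstacle inequality, the
  differential inequality and the minimality of the feedback enter in \<open>payoff_le_dynkin\<close>.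
\<close>

locale feedback_play = stopping_game T U V Q g h
  for T :: real and U :: "'u::topological_space set" and V :: "'v::topological_space set"
    and Q :: "real \<Rightarrow> 'u \<Rightarrow> 'v \<Rightarrow> real ^ 's ^ 's::finite"
    and g :: "real \<Rightarrow> 's \<Rightarrow> real" and h :: "real \<Rightarrow> 's \<Rightarrow> 'u \<Rightarrow> 'v \<Rightarrow> real" +
  fixes \<phi> :: "real \<Rightarrow> real ^ 's" and u_hat :: "real \<Rightarrow> 's \<Rightarrow> 'u" and t0 :: real and i0 :: 's
    and \<beta> :: "real \<Rightarrow> (real \<Rightarrow> 's) \<Rightarrow> 'v" and P :: "(real \<Rightarrow> 's) measure"
  assumes phi_AC: "\<phi> \<in> AC T"
    and terminal: "\<And>i. \<phi> T $ i = g T i"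
    and u_hat_feedback: "u_hat \<in> feedback_strategies T U"
    and t0: "t0 \<in> {0..T}"
    and beta: "\<beta> \<in> memory_strategies t0 T V"
    and law: "generated_law T Q t0 i0 (of_feedback u_hat) \<beta> P"
begin

abbreviation "M0 \<equiv> restrict_space (borel :: real measure) {t0..T}"

definition along :: "('s \<Rightarrow> real \<Rightarrow> 'u \<Rightarrow> 'v \<Rightarrow> real) \<Rightarrow> real \<Rightarrow> (real \<Rightarrow> 's) \<Rightarrow> real" where
  "along k s \<omega> = k (\<omega> s) s (u_hat s (\<omega> s)) (\<beta> s \<omega>)"

lemma prob_space_P: "prob_space P"
  and space_P: "space P = path_space t0 T"
  and sets_P: "sets P = sets (path_borel t0 T)"
  and initial: "measure P {\<omega> \<in> space P. \<omega> t0 = i0} = 1"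
  and dynkin_martingale: "martingale_on P (path_filtration t0 T) {t0..T}
      (dynkin_process T Q t0 (of_feedback u_hat) \<beta> \<phi>)"
  using law phi_AC unfolding generated_law_def by auto

lemma space_M0_P: "space (M0 \<Otimes>\<^sub>M P) = {t0..T} \<times> space P"
  by (simp add: space_pair_measure space_restrict_space)

lemma phi_continuous: "continuous_on {0..T} (\<lambda>t. \<phi> t $ i)"
  using phi_AC by (intro absolutely_continuous_imp_continuous) (simp add: AC_def)

lemma state_measurable: "(\<lambda>x. snd x (fst x)) \<in> M0 \<Otimes>\<^sub>M P \<rightarrow>\<^sub>M count_space UNIV"
proof -
  have "(\<lambda>x. snd x (fst x)) \<in> M0 \<Otimes>\<^sub>M path_borel t0 T \<rightarrow>\<^sub>M count_space (UNIV :: 's set)"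
    using path_eval_jointly_measurable[of t0 T] by (simp add: case_prod_beta')
  then show ?thesis
    by (subst measurable_cong_sets[OF sets_pair_measure_cong[OF refl sets_P] refl])
qed

lemma time_measurable: "fst \<in> M0 \<Otimes>\<^sub>M P \<rightarrow>\<^sub>M restrict_space borel {0..T}"
proof (rule measurable_restrict_space2)
  show "fst \<in> space (M0 \<Otimes>\<^sub>M P) \<rightarrow> {0..T}" using t0 by (auto simp: space_M0_P)
  show "fst \<in> M0 \<Otimes>\<^sub>M P \<rightarrow>\<^sub>M borel"
    by (rule measurable_compose[OF measurable_fst measurable_restrict_space1]) simp
qed

lemma u_hat_measurable: "(\<lambda>x. u_hat (fst x) (snd x (fst x))) \<in> M0 \<Otimes>\<^sub>M P \<rightarrow>\<^sub>M restrict_space borel U"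
proof (rule measurable_compose_countable'[OF _ state_measurable])
  show "(\<lambda>x. u_hat (fst x) i) \<in> M0 \<Otimes>\<^sub>M P \<rightarrow>\<^sub>M restrict_space borel U" for i
    using u_hat_feedback by (intro measurable_compose[OF time_measurable]) (simp add: feedback_strategies_def)
qed auto

lemma beta_measurable: "(\<lambda>x. \<beta> (fst x) (snd x)) \<in> M0 \<Otimes>\<^sub>M P \<rightarrow>\<^sub>M restrict_space borel V"
proof -
  have T: "T \<in> {t0..T}" using t0 by simp
  have sub: "subalgebra P (path_filtration t0 T T)"
    using dynkin_martingale T by (simp add: martingale_on_def)
  have "(\<lambda>\<omega>. \<omega>) \<in> P \<rightarrow>\<^sub>M path_filtration t0 T T"
    by (rule measurable_from_subalg[OF sub]) simp
  then have "(\<lambda>x. (fst x, snd x)) \<in> M0 \<Otimes>\<^sub>M P \<rightarrow>\<^sub>M M0 \<Otimes>\<^sub>M path_filtration t0 T T"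
    by (intro measurable_Pair measurable_fst measurable_compose[OF measurable_snd])
  moreover have "(\<lambda>(s, \<omega>). \<beta> s \<omega>) \<in> M0 \<Otimes>\<^sub>M path_filtration t0 T T \<rightarrow>\<^sub>M restrict_space borel V"
    using beta T unfolding memory_strategies_def by blast
  ultimately have "(\<lambda>x. case (fst x, snd x) of (s, \<omega>) \<Rightarrow> \<beta> s \<omega>) \<in> M0 \<Otimes>\<^sub>M P \<rightarrow>\<^sub>M restrict_space borel V"
    by (rule measurable_compose)
  then show ?thesis by (simp only: case_prod_conv)
qed

lemma along_measurable:
  assumes k: "\<And>i. continuous_on ({0..T} \<times> U \<times> V) (\<lambda>(t, u, v). k i t u v)"
  shows "(\<lambda>x. along k (fst x) (snd x)) \<in> borel_measurable (M0 \<Otimes>\<^sub>M P)"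
  unfolding along_def
proof (rule measurable_compose_countable'[where I = UNIV and g = "\<lambda>x. snd x (fst x)" and
      f = "\<lambda>i x. k i (fst x) (u_hat (fst x) (snd x (fst x))) (\<beta> (fst x) (snd x))", OF _ state_measurable])
  show "(\<lambda>x. k i (fst x) (u_hat (fst x) (snd x (fst x))) (\<beta> (fst x) (snd x))) \<in> borel_measurable (M0 \<Otimes>\<^sub>M P)" for i
    by (rule borel_measurable_compose_compact[OF _ U_compact V_compact k time_measurable
          u_hat_measurable beta_measurable]) simp
qed auto

lemma strategies_in:
  assumes "s \<in> {t0..T}" "\<omega> \<in> space P"
  shows "u_hat s (\<omega> s) \<in> U" "\<beta> s \<omega> \<in> V"
  using measurable_space[OF u_hat_measurable, of "(s, \<omega>)"] measurable_space[OF beta_measurable, of "(s, \<omega>)"]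
    assms by (auto simp: space_M0_P space_restrict_space)

lemma along_bounded:
  assumes k: "\<And>i. continuous_on ({0..T} \<times> U \<times> V) (\<lambda>(t, u, v). k i t u v)"
  obtains K where "0 \<le> K" "\<And>s \<omega>. s \<in> {t0..T} \<Longrightarrow> \<omega> \<in> space P \<Longrightarrow> \<bar>along k s \<omega>\<bar> \<le> K"
proof -
  have "\<exists>K. \<forall>z\<in>{0..T} \<times> U \<times> V. \<bar>(\<lambda>(t, u, v). k i t u v) z\<bar> \<le> K" for i
  proof -
    have "compact ((\<lambda>(t, u, v). k i t u v) ` ({0..T} \<times> U \<times> V))"
      using U_compact V_compact by (intro compact_continuous_image[OF k] compact_Times) auto
    then have "bounded ((\<lambda>(t, u, v). k i t u v) ` ({0..T} \<times> U \<times> V))" by (rule compact_imp_bounded)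
    then obtain K where "\<forall>y\<in>(\<lambda>(t, u, v). k i t u v) ` ({0..T} \<times> U \<times> V). norm y \<le> K"
      unfolding bounded_iff by blast
    then show ?thesis by (intro exI[of _ K] ballI) (metis image_eqI real_norm_def)
  qed
  then obtain K where K: "\<And>i z. z \<in> {0..T} \<times> U \<times> V \<Longrightarrow> \<bar>(\<lambda>(t, u, v). k i t u v) z\<bar> \<le> K i"
    by metis
  show thesis
  proof (rule that[of "\<Sum>i\<in>UNIV. \<bar>K i\<bar>"])
    fix s \<omega> assume s: "s \<in> {t0..T}" "\<omega> \<in> space P"
    have "\<bar>along k s \<omega>\<bar> \<le> K (\<omega> s)"
      using K[of "(s, u_hat s (\<omega> s), \<beta> s \<omega>)" "\<omega> s"] strategies_in[OF s] s t0 by (auto simp: along_def)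
    also have "\<dots> \<le> \<bar>K (\<omega> s)\<bar>" by simp
    also have "\<dots> \<le> (\<Sum>i\<in>UNIV. \<bar>K i\<bar>)" by (rule member_le_sum) auto
    finally show "\<bar>along k s \<omega>\<bar> \<le> (\<Sum>i\<in>UNIV. \<bar>K i\<bar>)" .
  qed (simp add: sum_nonneg)
qed

lemma along_path_measurable:
  assumes k: "\<And>i. continuous_on ({0..T} \<times> U \<times> V) (\<lambda>(t, u, v). k i t u v)" and \<omega>: "\<omega> \<in> space P"
  shows "(\<lambda>s. indicator {t0..T} s * along k s \<omega>) \<in> borel_measurable borel"
proof (rule borel_measurable_on_interval)
  show "(\<lambda>s. along k s \<omega>) \<in> borel_measurable M0"
    using measurable_compose[OF measurable_Pair2'[OF \<omega>] along_measurable[OF k]] by simp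
qed

lemma interval_dominating: "integrable lebesgue (\<lambda>s. indicator {t0..T} s * (K :: real))"
  using t0 by (intro integrable_mult_left integrable_real_indicator) auto

lemma along_integrable:
  assumes k: "\<And>i. continuous_on ({0..T} \<times> U \<times> V) (\<lambda>(t, u, v). k i t u v)"
  obtains R where "\<And>\<omega>. \<omega> \<in> space P \<Longrightarrow> set_integrable lebesgue {t0..T} (\<lambda>s. along k s \<omega>)"
    "\<And>\<omega> t. \<omega> \<in> space P \<Longrightarrow> t \<in> {t0..T} \<Longrightarrow> \<bar>LINT s:{t0..t}|lebesgue. along k s \<omega>\<bar> \<le> R"
proof -
  obtain K where K: "0 \<le> K" "\<And>s \<omega>. s \<in> {t0..T} \<Longrightarrow> \<omega> \<in> space P \<Longrightarrow> \<bar>along k s \<omega>\<bar> \<le> K"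
    by (rule along_bounded[OF k]) (rule that)
  have meas: "(\<lambda>s. indicator {t0..T} s * along k s \<omega>) \<in> borel_measurable lebesgue" if "\<omega> \<in> space P" for \<omega>
    using along_path_measurable[OF k that] by (intro measurable_completion) simp
  have "AE s in lebesgue. s \<in> {t0..T} \<longrightarrow> \<bar>along k s \<omega>\<bar> \<le> indicator {t0..T} s * K" if "\<omega> \<in> space P" for \<omega>
    using K(2) that by (intro AE_I2) auto
  note * = dominated_set_integral[OF interval_dominating meas this]
  show thesis by (rule that[OF *(1) *(2)])
qed

definition generator_term :: "'s \<Rightarrow> real \<Rightarrow> 'u \<Rightarrow> 'v \<Rightarrow> real" where
  "generator_term i t u v = (\<Sum>j\<in>UNIV. Q t u v $ i $ j * \<phi> t $ j)"

lemma generator_term_continuous: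
  "continuous_on ({0..T} \<times> U \<times> V) (\<lambda>(t, u, v). generator_term i t u v)"
proof -
  have "continuous_on ({0..T} \<times> U \<times> V) (\<lambda>z. \<phi> (fst z) $ j)" for j
    by (rule continuous_on_compose2[OF phi_continuous continuous_on_fst[OF continuous_on_id]]) auto
  then have "continuous_on ({0..T} \<times> U \<times> V) (\<lambda>z. \<Sum>j\<in>UNIV. (\<lambda>(t, u, v). Q t u v $ i $ j) z * \<phi> (fst z) $ j)"
    by (intro continuous_on_sum continuous_on_mult Q_continuous)
  then show ?thesis by (simp add: generator_term_def case_prod_beta')
qed

definition drift :: "real \<Rightarrow> (real \<Rightarrow> 's) \<Rightarrow> real" where
  "drift s \<omega> = time_deriv T \<phi> s (\<omega> s) + along generator_term s \<omega>"

lemma dynkin_eq: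
  "dynkin_process T Q t0 (of_feedback u_hat) \<beta> \<phi> t \<omega> = \<phi> t $ \<omega> t - (LINT s:{t0..t}|lebesgue. drift s \<omega>)"
  by (simp add: dynkin_process_def drift_def along_def generator_term_def of_feedback_def)

lemma phi_derivative:
  obtains D where "\<And>i. integrable lborel (D i)"
    "AE s in lebesgue. \<forall>i. s \<in> {0..T} \<longrightarrow>
      ((\<lambda>s. \<phi> s $ i) has_real_derivative D i s) (at s within {0..T}) \<and> time_deriv T \<phi> s i = D i s"
proof -
  have "\<exists>D. integrable lborel D \<and>
      (AE s in lborel. s \<in> {0..T} \<longrightarrow> ((\<lambda>s. \<phi> s $ i) has_real_derivative D s) (at s within {0..T}))" for i
    using absolutely_continuous_derivative[of 0 T "\<lambda>s. \<phi> s $ i"] phi_AC T_pos by (auto simp: AC_def)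
  then have "\<forall>i. \<exists>D. integrable lborel D \<and>
      (AE s in lborel. s \<in> {0..T} \<longrightarrow> ((\<lambda>s. \<phi> s $ i) has_real_derivative D s) (at s within {0..T}))" ..
  from choice[OF this] obtain D where D: "\<And>i. integrable lborel (D i)"
    "\<And>i. AE s in lborel. s \<in> {0..T} \<longrightarrow> ((\<lambda>s. \<phi> s $ i) has_real_derivative D i s) (at s within {0..T})"
    by blast
  have eq: "time_deriv T \<phi> s i = D i s"
    if "s \<in> {0..T}" "((\<lambda>s. \<phi> s $ i) has_real_derivative D i s) (at s within {0..T})" for i s
    unfolding time_deriv_def using that T_pos
    by (intro vector_derivative_within_closed_interval) (auto simp: has_real_derivative_iff_has_vector_derivative)
  have "AE s in lebesgue. s \<in> {0..T} \<longrightarrow> ((\<lambda>s. \<phi> s $ i) has_real_derivative D i s) (at s within {0..T})" for i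
    by (rule AE_completion[OF D(2)])
  then have "AE s in lebesgue. \<forall>i. s \<in> {0..T} \<longrightarrow> ((\<lambda>s. \<phi> s $ i) has_real_derivative D i s) (at s within {0..T})"
    by (intro AE_all_countable[THEN iffD2] allI)
  then have "AE s in lebesgue. \<forall>i. s \<in> {0..T} \<longrightarrow>
      ((\<lambda>s. \<phi> s $ i) has_real_derivative D i s) (at s within {0..T}) \<and> time_deriv T \<phi> s i = D i s"
    by eventually_elim (use eq in blast)
  with D(1) show thesis by (rule that)
qed

lemma drift_integrable:
  obtains R where "\<And>\<omega>. \<omega> \<in> space P \<Longrightarrow> set_integrable lebesgue {t0..T} (\<lambda>s. drift s \<omega>)"
    "\<And>\<omega> t. \<omega> \<in> space P \<Longrightarrow> t \<in> {t0..T} \<Longrightarrow> \<bar>LINT s:{t0..t}|lebesgue. drift s \<omega>\<bar> \<le> R"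
proof -
  obtain D where D: "\<And>i. integrable lborel (D i)"
    "AE s in lebesgue. \<forall>i. s \<in> {0..T} \<longrightarrow>
      ((\<lambda>s. \<phi> s $ i) has_real_derivative D i s) (at s within {0..T}) \<and> time_deriv T \<phi> s i = D i s"
    by (rule phi_derivative) (rule that)
  obtain K where K: "0 \<le> K" "\<And>s \<omega>. s \<in> {t0..T} \<Longrightarrow> \<omega> \<in> space P \<Longrightarrow> \<bar>along generator_term s \<omega>\<bar> \<le> K"
    by (rule along_bounded[OF generator_term_continuous]) (rule that)
  define w where "w s = (\<Sum>i\<in>UNIV. \<bar>D i s\<bar>) + indicator {t0..T} s * K" for s
  have Dleb: "integrable lebesgue (D i)" for i
    using D(1)[of i] by (subst integrable_completion) auto
  have w: "integrable lebesgue w"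
    unfolding w_def using Dleb
    by (intro Bochner_Integration.integrable_add Bochner_Integration.integrable_sum interval_dominating) auto
  have le: "AE s in lebesgue. s \<in> {t0..T} \<longrightarrow> \<bar>drift s \<omega>\<bar> \<le> w s" if \<omega>: "\<omega> \<in> space P" for \<omega>
    using D(2)
  proof eventually_elim
    case (elim s)
    show ?case
    proof
      assume s: "s \<in> {t0..T}"
      then have "time_deriv T \<phi> s (\<omega> s) = D (\<omega> s) s" using elim t0 by auto
      moreover have "\<bar>D (\<omega> s) s\<bar> \<le> (\<Sum>i\<in>UNIV. \<bar>D i s\<bar>)" by (rule member_le_sum) auto
      ultimately show "\<bar>drift s \<omega>\<bar> \<le> w s"
        using K(2)[OF s \<omega>] s unfolding drift_def w_def by simp
    qed
  qed
  have meas: "(\<lambda>s. indicator {t0..T} s * drift s \<omega>) \<in> borel_measurable lebesgue" if \<omega>: "\<omega> \<in> space P" for \<omega>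
  proof (rule borel_measurable_AE)
    let ?f = "\<lambda>s. indicator {t0..T} s * D (\<omega> s) s + indicator {t0..T} s * along generator_term s \<omega>"
    have "(\<lambda>s. D (\<omega> s) s) \<in> borel_measurable M0"
    proof (rule measurable_compose_countable'[where f = D and g = \<omega> and I = UNIV])
      show "\<omega> \<in> M0 \<rightarrow>\<^sub>M count_space UNIV"
        using measurable_compose[OF measurable_Pair2'[OF \<omega>] state_measurable] by simp
      show "D i \<in> borel_measurable M0" for i
        using borel_measurable_integrable[OF D(1)[of i]] by (intro measurable_restrict_space1) simp
    qed auto
    then have "?f \<in> borel_measurable borel"
      by (intro borel_measurable_add borel_measurable_on_interval[of "\<lambda>s. D (\<omega> s) s"]
          along_path_measurable generator_term_continuous \<omega>)
    then show "?f \<in> borel_measurable lebesgue" by (intro measurable_completion) simp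
    show "AE s in lebesgue. ?f s = indicator {t0..T} s * drift s \<omega>"
      using D(2)
    proof eventually_elim
      case (elim s)
      then show ?case using t0 by (auto simp: drift_def indicator_def algebra_simps)
    qed
  qed
  note * = dominated_set_integral[OF w meas le]
  show thesis by (rule that[OF *(1) *(2)])
qed

lemma phi_path_right_continuous:
  assumes \<omega>: "\<omega> \<in> space P" and s: "s \<in> {t0..T}"
  shows "continuous (at s within {s..T}) (\<lambda>r. \<phi> r $ \<omega> r)"
proof (cases "s = T")
  case True
  moreover have "at T within {T} = bot" using at_within_eq_bot_iff[of T "{T}"] by simp
  ultimately show ?thesis by (simp add: continuous_within)
next
  case False
  then have "s \<in> {t0..<T}" using s by simp
  then obtain e where e: "0 < e" "s + e \<le> T" "\<And>r. s \<le> r \<Longrightarrow> r < s + e \<Longrightarrow> \<omega> r = \<omega> s"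
    by (rule path_space_right_constant[OF \<omega>[unfolded space_P]]) (rule that)
  have "continuous (at s within {0..T}) (\<lambda>r. \<phi> r $ \<omega> s)"
    using phi_continuous s t0 by (auto simp: continuous_on_eq_continuous_within)
  then have "continuous (at s within {s..T}) (\<lambda>r. \<phi> r $ \<omega> s)"
    by (rule continuous_within_subset) (use s t0 in auto)
  then show ?thesis
  proof (rule continuous_transform_within[OF _ e(1)])
    show "\<phi> r $ \<omega> s = \<phi> r $ \<omega> r" if "r \<in> {s..T}" "dist r s < e" for r
      using e(3)[of r] that by (simp add: dist_real_def)
  qed (use s in auto)
qed

lemma dynkin_right_continuous:
  assumes \<omega>: "\<omega> \<in> space P" and s: "s \<in> {t0..T}"
  shows "continuous (at s within {s..T}) (\<lambda>r. dynkin_process T Q t0 (of_feedback u_hat) \<beta> \<phi> r \<omega>)"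
  unfolding dynkin_eq
proof (intro continuous_diff phi_path_right_continuous[OF assms])
  obtain R where int: "\<And>\<omega>. \<omega> \<in> space P \<Longrightarrow> set_integrable lebesgue {t0..T} (\<lambda>s. drift s \<omega>)"
    and "\<And>\<omega> t. \<omega> \<in> space P \<Longrightarrow> t \<in> {t0..T} \<Longrightarrow> \<bar>LINT s:{t0..t}|lebesgue. drift s \<omega>\<bar> \<le> R"
    by (rule drift_integrable) (rule that)
  have eq: "(LINT s:{t0..t}|lebesgue. drift s \<omega>) = integral {t0..t} (\<lambda>s. drift s \<omega>)" if "t \<in> {t0..T}" for t
    using int[OF \<omega>] that by (intro set_lebesgue_integral_eq_integral(2)) (auto elim: set_integrable_subset)
  have "(\<lambda>s. drift s \<omega>) integrable_on {t0..T}"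
    by (rule set_lebesgue_integral_eq_integral(1)[OF int[OF \<omega>]])
  from indefinite_integral_continuous_1[OF this]
  have "continuous_on {t0..T} (\<lambda>t. LINT s:{t0..t}|lebesgue. drift s \<omega>)"
    by (rule continuous_on_eq) (simp add: eq)
  then have "continuous (at s within {t0..T}) (\<lambda>t. LINT s:{t0..t}|lebesgue. drift s \<omega>)"
    using s by (auto simp: continuous_on_eq_continuous_within)
  then show "continuous (at s within {s..T}) (\<lambda>t. LINT s:{t0..t}|lebesgue. drift s \<omega>)"
    by (rule continuous_within_subset) (use s in auto)
qed

lemma phi_bounded:
  obtains K where "\<And>s i. s \<in> {0..T} \<Longrightarrow> \<bar>\<phi> s $ i\<bar> \<le> K"
proof -
  have "bounded ((\<lambda>s. \<phi> s $ i) ` {0..T})" for i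
    using phi_continuous by (intro compact_imp_bounded compact_continuous_image) auto
  then have "\<exists>K. \<forall>s\<in>{0..T}. \<bar>\<phi> s $ i\<bar> \<le> K" for i
    unfolding bounded_iff by auto
  then obtain K where K: "\<And>i s. s \<in> {0..T} \<Longrightarrow> \<bar>\<phi> s $ i\<bar> \<le> K i" by metis
  have "\<bar>\<phi> s $ i\<bar> \<le> (\<Sum>i\<in>UNIV. \<bar>K i\<bar>)" if "s \<in> {0..T}" for s i
  proof -
    have "\<bar>\<phi> s $ i\<bar> \<le> \<bar>K i\<bar>" using K[OF that, of i] by simp
    also have "\<dots> \<le> (\<Sum>i\<in>UNIV. \<bar>K i\<bar>)" by (rule member_le_sum) auto
    finally show ?thesis .
  qed
  then show thesis by (rule that)
qed

definition contact :: "'s \<Rightarrow> real set" where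
  "contact i = {t \<in> {0..T}. \<phi> t $ i = g t i}"

lemma closed_contact: "closed (contact i)"
proof -
  have "closed {t \<in> {0..T}. \<phi> t $ i - g t i = 0}"
    using phi_continuous g_continuous
    by (intro continuous_closed_preimage_constant continuous_on_diff) auto
  then show ?thesis by (simp add: contact_def)
qed

abbreviation "\<tau> \<equiv> hitting_time T g \<phi> t0"

text \<open>
  The time \<open>T\<close> is always a hit because of the terminal condition, so the least hit exists.
\<close>

lemma hitting_time_properties:
  assumes \<omega>: "\<omega> \<in> space P"
  shows "\<tau> \<omega> \<in> {t0..T}" "\<phi> (\<tau> \<omega>) $ \<omega> (\<tau> \<omega>) = g (\<tau> \<omega>) (\<omega> (\<tau> \<omega>))"
    "\<And>s. s \<in> {t0..T} \<Longrightarrow> \<phi> s $ \<omega> s = g s (\<omega> s) \<Longrightarrow> \<tau> \<omega> \<le> s"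
proof -
  have \<omega>': "\<omega> \<in> path_space t0 T" and le: "t0 \<le> T" using \<omega> t0 by (auto simp: space_P)
  have "T \<in> contact (\<omega> T)" using T_pos terminal by (simp add: contact_def)
  then obtain m where m: "m \<in> {t0..T}" "m \<in> contact (\<omega> m)"
    "\<And>s. s \<in> {t0..T} \<Longrightarrow> s \<in> contact (\<omega> s) \<Longrightarrow> m \<le> s"
    by (rule first_hit_attained[OF closed_contact \<omega>' le]) (rule that)
  have min: "m \<le> s" if "s \<in> {t0..T}" "\<phi> s $ \<omega> s = g s (\<omega> s)" for s
    using m(3)[OF that(1)] that t0 by (simp add: contact_def)
  have "\<tau> \<omega> = m"
    unfolding hitting_time_def using m min by (intro Least_equality) (auto simp: contact_def)
  then show "\<tau> \<omega> \<in> {t0..T}" "\<phi> (\<tau> \<omega>) $ \<omega> (\<tau> \<omega>) = g (\<tau> \<omega>) (\<omega> (\<tau> \<omega>))"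
    "\<And>s. s \<in> {t0..T} \<Longrightarrow> \<phi> s $ \<omega> s = g s (\<omega> s) \<Longrightarrow> \<tau> \<omega> \<le> s"
    using m min by (auto simp: contact_def)
qed

lemma hitting_time_stopping:
  assumes t: "t \<in> {t0..T}"
  shows "{\<omega> \<in> space P. \<tau> \<omega> \<le> t} \<in> sets (path_filtration t0 T t)"
proof -
  have "{\<omega> \<in> space P. \<tau> \<omega> \<le> t} = {\<omega> \<in> path_space t0 T. \<exists>s\<in>{t0..t}. s \<in> contact (\<omega> s)}"
  proof (intro set_eqI iffI)
    fix \<omega> assume "\<omega> \<in> {\<omega> \<in> space P. \<tau> \<omega> \<le> t}"
    then have \<omega>: "\<omega> \<in> space P" "\<tau> \<omega> \<le> t" by auto
    then show "\<omega> \<in> {\<omega> \<in> path_space t0 T. \<exists>s\<in>{t0..t}. s \<in> contact (\<omega> s)}"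
      using hitting_time_properties(1,2)[OF \<omega>(1)] t0
      by (auto simp: space_P contact_def intro!: bexI[of _ "\<tau> \<omega>"])
  next
    fix \<omega> assume "\<omega> \<in> {\<omega> \<in> path_space t0 T. \<exists>s\<in>{t0..t}. s \<in> contact (\<omega> s)}"
    then obtain s where s: "\<omega> \<in> space P" "s \<in> {t0..t}" "\<phi> s $ \<omega> s = g s (\<omega> s)"
      by (auto simp: space_P contact_def)
    then have "\<tau> \<omega> \<le> s" using t by (intro hitting_time_properties(3)) auto
    then show "\<omega> \<in> {\<omega> \<in> space P. \<tau> \<omega> \<le> t}" using s by auto
  qed
  then show ?thesis using hitting_event_adapted[OF closed_contact t] by simp
qed

abbreviation "X \<equiv> dynkin_process T Q t0 (of_feedback u_hat) \<beta> \<phi>"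

lemma dynkin_bounded:
  obtains K where "\<And>\<omega> s. \<omega> \<in> space P \<Longrightarrow> s \<in> {t0..T} \<Longrightarrow> \<bar>X s \<omega>\<bar> \<le> K"
proof -
  obtain R where "\<And>\<omega>. \<omega> \<in> space P \<Longrightarrow> set_integrable lebesgue {t0..T} (\<lambda>s. drift s \<omega>)"
    and R: "\<And>\<omega> t. \<omega> \<in> space P \<Longrightarrow> t \<in> {t0..T} \<Longrightarrow> \<bar>LINT s:{t0..t}|lebesgue. drift s \<omega>\<bar> \<le> R"
    by (rule drift_integrable) (rule that)
  obtain K where K: "\<And>s i. s \<in> {0..T} \<Longrightarrow> \<bar>\<phi> s $ i\<bar> \<le> K"
    by (rule phi_bounded) (rule that)
  have "\<bar>X s \<omega>\<bar> \<le> K + R" if "\<omega> \<in> space P" "s \<in> {t0..T}" for \<omega> s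
    using R[OF that] K[of s "\<omega> s"] that t0 unfolding dynkin_eq by auto
  then show thesis by (rule that)
qed

lemma dynkin_initial_expectation: "(\<integral>\<omega>. X t0 \<omega> \<partial>P) = \<phi> t0 $ i0"
proof -
  interpret prob_space P by (rule prob_space_P)
  have zero: "(LINT s:{t0..t0}|lebesgue. drift s \<omega>) = 0" for \<omega>
    unfolding set_lebesgue_integral_def
  proof (rule integral_eq_zero_AE)
    have "AE s in lebesgue. s \<noteq> t0" by (rule AE_completion[OF AE_lborel_singleton])
    then show "AE s in lebesgue. indicat_real {t0..t0} s *\<^sub>R drift s \<omega> = 0"
      by eventually_elim auto
  qed
  have "AE \<omega> in P. \<omega> t0 = i0"
    using AE_prob_1[OF initial] by eventually_elim auto
  then have "AE \<omega> in P. X t0 \<omega> = \<phi> t0 $ i0"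
    by eventually_elim (simp only: dynkin_eq zero diff_zero)
  then have "(\<integral>\<omega>. X t0 \<omega> \<partial>P) = (\<integral>\<omega>. \<phi> t0 $ i0 \<partial>P)"
    using dynkin_martingale t0
    by (intro integral_cong_AE) (auto simp: martingale_on_def intro: borel_measurable_integrable)
  then show ?thesis by (simp add: prob_space)
qed

lemma dynkin_stopped:
  shows "integrable P (\<lambda>\<omega>. X (\<tau> \<omega>) \<omega>)" and "(\<integral>\<omega>. X (\<tau> \<omega>) \<omega> \<partial>P) = \<phi> t0 $ i0"
proof -
  obtain K where K: "\<And>\<omega> s. \<omega> \<in> space P \<Longrightarrow> s \<in> {t0..T} \<Longrightarrow> \<bar>X s \<omega>\<bar> \<le> K"
    by (rule dynkin_bounded) (rule that)
  have le: "t0 \<le> T" using t0 by simp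
  note stop = optional_stopping[OF prob_space_P dynkin_martingale le hitting_time_properties(1)
      hitting_time_stopping dynkin_right_continuous K]
  show "integrable P (\<lambda>\<omega>. X (\<tau> \<omega>) \<omega>)" by (rule stop(1))
  have "(\<integral>\<omega>. X t0 \<omega> \<partial>P) = (\<integral>\<omega>. X T \<omega> \<partial>P)"
  proof (rule optional_stopping_finite(2)[OF prob_space_P dynkin_martingale, of "{t0}" T "\<lambda>_. t0"])
    have "space P = space (path_filtration t0 T t0)" by (simp add: space_P)
    then show "{\<omega> \<in> space P. t0 = a} \<in> sets (path_filtration t0 T a)" if "a \<in> {t0}" for a
      using that sets.top[of "path_filtration t0 T t0"] by (simp del: sets.top)
  qed (use le in auto)
  then show "(\<integral>\<omega>. X (\<tau> \<omega>) \<omega> \<partial>P) = \<phi> t0 $ i0"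
    using stop(2) dynkin_initial_expectation by simp
qed

lemma hitting_time_measurable: "\<tau> \<in> P \<rightarrow>\<^sub>M M0"
proof (rule measurable_restrict_space2)
  show "\<tau> \<in> space P \<rightarrow> {t0..T}" using hitting_time_properties(1) by blast
  show "\<tau> \<in> borel_measurable P"
  proof (rule borel_measurable_iff_le[THEN iffD2], rule allI)
    fix r
    consider "T \<le> r" | "r < t0" | "r \<in> {t0..T}" by fastforce
    then show "{\<omega> \<in> space P. \<tau> \<omega> \<le> r} \<in> sets P"
    proof cases
      case 1
      then have "{\<omega> \<in> space P. \<tau> \<omega> \<le> r} = space P"
        using hitting_time_properties(1) by (fastforce intro: order_trans)
      then show ?thesis by (simp only: sets.top)
    next
      case 2
      then have "{\<omega> \<in> space P. \<tau> \<omega> \<le> r} = {}"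
        using hitting_time_properties(1) by (fastforce dest: order_trans)
      then show ?thesis by (simp only: sets.empty_sets)
    next
      case 3
      then have "sets (path_filtration t0 T r) \<subseteq> sets P"
        using dynkin_martingale by (simp add: martingale_on_def subalgebra_def)
      then show ?thesis using hitting_time_stopping[OF 3] by blast
    qed
  qed
qed

text \<open>
  \<open>h\<close> with the argument order that \<open>along\<close> expects.
\<close>

definition running_payoff :: "'s \<Rightarrow> real \<Rightarrow> 'u \<Rightarrow> 'v \<Rightarrow> real" where
  "running_payoff i t u v = h t i u v"

lemma running_payoff_continuous:
  "continuous_on ({0..T} \<times> U \<times> V) (\<lambda>(t, u, v). running_payoff i t u v)"
  using h_continuous by (simp add: running_payoff_def)

lemma payoff_eq:
  "payoff g h t0 (of_feedback u_hat) \<beta> t \<omega>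
    = g t (\<omega> t) + (LINT s:{t0..t}|lebesgue. along running_payoff s \<omega>)"
  by (simp add: payoff_def along_def running_payoff_def of_feedback_def)

text \<open>
  The random upper limit of integration is moved into the integrand, which makes the assertion an
  instance of Fubini measurability.
\<close>

lemma running_payoff_measurable:
  "(\<lambda>\<omega>. LINT s:{t0..\<tau> \<omega>}|lebesgue. along running_payoff s \<omega>) \<in> borel_measurable P"
proof -
  let ?L = "restrict_space lborel {t0..T}"
  interpret L: finite_measure ?L
    using t0 by (intro finite_measureI) (simp add: emeasure_restrict_space space_restrict_space)
  define f where "f \<omega> s = (if s \<le> \<tau> \<omega> then along running_payoff s \<omega> else 0)" for \<omega> s
  have sets_L: "sets ?L = sets M0" by (intro sets_restrict_space_cong) simp
  have [measurable]: "\<tau> \<in> borel_measurable P"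
    using measurable_restrict_space2_iff[THEN iffD1, OF hitting_time_measurable] by blast
  have [measurable]: "fst \<in> borel_measurable (M0 \<Otimes>\<^sub>M P)"
    using measurable_restrict_space2_iff[THEN iffD1, OF time_measurable] by blast
  note along_measurable[OF running_payoff_continuous, measurable]
  have "(\<lambda>x. f (snd x) (fst x)) \<in> borel_measurable (M0 \<Otimes>\<^sub>M P)"
    unfolding f_def by measurable
  from measurable_compose[OF measurable_pair_swap' this]
  have "case_prod f \<in> borel_measurable (P \<Otimes>\<^sub>M M0)"
    by (simp add: case_prod_beta')
  then have "case_prod f \<in> borel_measurable (P \<Otimes>\<^sub>M ?L)"
    by (subst measurable_cong_sets[OF sets_pair_measure_cong[OF refl sets_L] refl])
  then have "(\<lambda>\<omega>. \<integral>s. f \<omega> s \<partial>?L) \<in> borel_measurable P"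
    by (rule L.borel_measurable_lebesgue_integral)
  moreover have "(LINT s:{t0..\<tau> \<omega>}|lebesgue. along running_payoff s \<omega>) = (\<integral>s. f \<omega> s \<partial>?L)"
    if \<omega>: "\<omega> \<in> space P" for \<omega>
  proof -
    have "indicator {t0..\<tau> \<omega>} s *\<^sub>R along running_payoff s \<omega> = indicator {t0..T} s *\<^sub>R f \<omega> s" for s
      using hitting_time_properties(1)[OF \<omega>] by (auto simp: f_def indicator_def)
    then have "(LINT s:{t0..\<tau> \<omega>}|lebesgue. along running_payoff s \<omega>)
        = (\<integral>s. indicator {t0..T} s *\<^sub>R f \<omega> s \<partial>lebesgue)"
      by (simp add: set_lebesgue_integral_def)
    also have "\<dots> = (\<integral>s. indicator {t0..T} s *\<^sub>R f \<omega> s \<partial>lborel)"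
    proof (rule integral_completion)
      have "(\<lambda>s. indicator {..\<tau> \<omega>} s * (indicator {t0..T} s * along running_payoff s \<omega>)) \<in> borel_measurable borel"
        using along_path_measurable[OF running_payoff_continuous \<omega>] by measurable
      moreover have "(\<lambda>s. indicator {..\<tau> \<omega>} s * (indicator {t0..T} s * along running_payoff s \<omega>))
          = (\<lambda>s. indicator {t0..T} s *\<^sub>R f \<omega> s)"
        by (auto simp: f_def indicator_def)
      ultimately show "(\<lambda>s. indicator {t0..T} s *\<^sub>R f \<omega> s) \<in> borel_measurable lborel" by simp
    qed
    also have "\<dots> = (\<integral>s. f \<omega> s \<partial>?L)"
      by (rule integral_restrict_space[symmetric]) simp
    finally show ?thesis .
  qed
  ultimately show ?thesis
    by (subst measurable_cong[of P _ "\<lambda>\<omega>. \<integral>s. f \<omega> s \<partial>?L"]) auto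
qed

lemma payoff_integrable: "integrable P (\<lambda>\<omega>. payoff g h t0 (of_feedback u_hat) \<beta> (\<tau> \<omega>) \<omega>)"
proof -
  interpret prob_space P by (rule prob_space_P)
  obtain K where K: "\<And>s i. s \<in> {0..T} \<Longrightarrow> \<bar>\<phi> s $ i\<bar> \<le> K"
    by (rule phi_bounded) (rule that)
  obtain R where "\<And>\<omega>. \<omega> \<in> space P \<Longrightarrow> set_integrable lebesgue {t0..T} (\<lambda>s. along running_payoff s \<omega>)"
    and R: "\<And>\<omega> t. \<omega> \<in> space P \<Longrightarrow> t \<in> {t0..T} \<Longrightarrow> \<bar>LINT s:{t0..t}|lebesgue. along running_payoff s \<omega>\<bar> \<le> R"
    by (rule along_integrable[OF running_payoff_continuous]) (rule that)
  have pair: "(\<lambda>\<omega>. (\<tau> \<omega>, \<omega>)) \<in> P \<rightarrow>\<^sub>M M0 \<Otimes>\<^sub>M P"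
    by (intro measurable_Pair hitting_time_measurable measurable_ident_sets refl)
  have "(\<lambda>\<omega>. g (\<tau> \<omega>) (\<omega> (\<tau> \<omega>))) \<in> borel_measurable P"
  proof (rule measurable_compose_countable'[where I = UNIV and f = "\<lambda>i \<omega>. g (\<tau> \<omega>) i" and g = "\<lambda>\<omega>. \<omega> (\<tau> \<omega>)"])
    show "(\<lambda>\<omega>. \<omega> (\<tau> \<omega>)) \<in> P \<rightarrow>\<^sub>M count_space UNIV"
      using measurable_compose[OF pair state_measurable] by simp
    have "\<tau> \<in> P \<rightarrow>\<^sub>M restrict_space borel {0..T}"
      using measurable_compose[OF pair time_measurable] by simp
    then show "(\<lambda>\<omega>. g (\<tau> \<omega>) i) \<in> borel_measurable P" for i
      by (rule measurable_compose) (rule borel_measurable_continuous_on_restrict[OF g_continuous])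
  qed auto
  then have meas: "(\<lambda>\<omega>. payoff g h t0 (of_feedback u_hat) \<beta> (\<tau> \<omega>) \<omega>) \<in> borel_measurable P"
    unfolding payoff_eq by (intro borel_measurable_add running_payoff_measurable)
  have "\<bar>payoff g h t0 (of_feedback u_hat) \<beta> (\<tau> \<omega>) \<omega>\<bar> \<le> K + R" if \<omega>: "\<omega> \<in> space P" for \<omega>
    unfolding payoff_eq hitting_time_properties(2)[OF \<omega>, symmetric]
    using R[OF \<omega> hitting_time_properties(1)[OF \<omega>]] K[of "\<tau> \<omega>" "\<omega> (\<tau> \<omega>)"] hitting_time_properties(1)[OF \<omega>] t0
    by auto
  then show ?thesis
    by (intro integrable_const_bound[where B = "K + R"] AE_I2 meas) auto
qed

text \<open>
  Against the minimizing feedback no choice of the second player exceeds the upper value.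
\<close>

lemma hamiltonian_ge:
  assumes s: "s \<in> {t0..T}" and \<omega>: "\<omega> \<in> space P"
    and argmin: "is_arg_min (\<lambda>u. SUP v\<in>V. pre_hamiltonian Q h s (\<omega> s) (\<phi> s) u v) (\<lambda>u. u \<in> U) (u_hat s (\<omega> s))"
  shows "along generator_term s \<omega> + along running_payoff s \<omega> \<le> hamiltonian U V Q h s (\<omega> s) (\<phi> s)"
proof -
  let ?u = "u_hat s (\<omega> s)" and ?p = "pre_hamiltonian Q h s (\<omega> s) (\<phi> s)"
  have s': "s \<in> {0..T}" using s t0 by auto
  note u = strategies_in(1)[OF s \<omega>] and v = strategies_in(2)[OF s \<omega>]
  have slice: "continuous_on V (\<lambda>v. (s, ?u, v))" by (intro continuous_intros)
  have sub: "(\<lambda>v. (s, ?u, v)) ` V \<subseteq> {0..T} \<times> U \<times> V" using s' u by auto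
  have "continuous_on V (\<lambda>v. generator_term (\<omega> s) s ?u v + running_payoff (\<omega> s) s ?u v)"
    using continuous_on_compose2[OF generator_term_continuous slice sub]
      continuous_on_compose2[OF running_payoff_continuous slice sub]
    by (intro continuous_on_add) auto
  moreover have p_eq: "?p ?u = (\<lambda>v. generator_term (\<omega> s) s ?u v + running_payoff (\<omega> s) s ?u v)"
    by (simp add: fun_eq_iff pre_hamiltonian_def generator_term_def running_payoff_def)
  ultimately have "compact (?p ?u ` V)"
    using V_compact by (intro compact_continuous_image) auto
  then have bdd: "bdd_above (?p ?u ` V)"
    by (intro bounded_imp_bdd_above compact_imp_bounded)
  have "along generator_term s \<omega> + along running_payoff s \<omega> = ?p ?u (\<beta> s \<omega>)"
    by (simp add: p_eq along_def)
  also have "\<dots> \<le> (SUP v\<in>V. ?p ?u v)" by (rule cSUP_upper[OF v bdd])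
  also have "\<dots> \<le> hamiltonian U V Q h s (\<omega> s) (\<phi> s)"
    unfolding hamiltonian_def using argmin U_nonempty
    by (intro cINF_greatest) (auto simp: is_arg_min_linorder)
  finally show ?thesis .
qed

text \<open>
  Strictly before the hitting time the path stays below the obstacle, so the differential inequality
  and the minimality of the feedback make the running payoff at most the negative drift; at the hitting
  time itself \<open>\<phi>\<close> and \<open>g\<close> agree. The inequality is available at almost every time, as \<open>\<phi>\<close> is
  differentiable almost everywhere.
\<close>

lemma payoff_le_dynkin:
  assumes obstacle: "\<And>t i. t \<in> {0..T} \<Longrightarrow> \<phi> t $ i \<le> g t i"
    and upper:
      "\<And>t i. t \<in> {0..T} \<Longrightarrow> (\<lambda>s. \<phi> s $ i) differentiable (at t within {0..T}) \<Longrightarrow>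
        \<phi> t $ i < g t i \<Longrightarrow> time_deriv T \<phi> t i \<le> - hamiltonian U V Q h t i (\<phi> t)"
    and argmin:
      "\<And>t i. t \<in> {0..T} \<Longrightarrow>
        is_arg_min (\<lambda>u. SUP v\<in>V. pre_hamiltonian Q h t i (\<phi> t) u v) (\<lambda>u. u \<in> U) (u_hat t i)"
    and \<omega>: "\<omega> \<in> space P"
  shows "payoff g h t0 (of_feedback u_hat) \<beta> (\<tau> \<omega>) \<omega> \<le> X (\<tau> \<omega>) \<omega>"
proof -
  note \<tau> = hitting_time_properties[OF \<omega>]
  obtain D where "\<And>i. integrable lborel (D i)" and D:
    "AE s in lebesgue. \<forall>i. s \<in> {0..T} \<longrightarrow>
      ((\<lambda>s. \<phi> s $ i) has_real_derivative D i s) (at s within {0..T}) \<and> time_deriv T \<phi> s i = D i s"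
    by (rule phi_derivative) (rule that)
  obtain R where int1: "\<And>\<omega>. \<omega> \<in> space P \<Longrightarrow> set_integrable lebesgue {t0..T} (\<lambda>s. drift s \<omega>)"
    and "\<And>\<omega> t. \<omega> \<in> space P \<Longrightarrow> t \<in> {t0..T} \<Longrightarrow> \<bar>LINT s:{t0..t}|lebesgue. drift s \<omega>\<bar> \<le> R"
    by (rule drift_integrable) (rule that)
  obtain R' where int2: "\<And>\<omega>. \<omega> \<in> space P \<Longrightarrow> set_integrable lebesgue {t0..T} (\<lambda>s. along running_payoff s \<omega>)"
    and "\<And>\<omega> t. \<omega> \<in> space P \<Longrightarrow> t \<in> {t0..T} \<Longrightarrow> \<bar>LINT s:{t0..t}|lebesgue. along running_payoff s \<omega>\<bar> \<le> R'"
    by (rule along_integrable[OF running_payoff_continuous]) (rule that)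
  have "AE s in lebesgue. s \<noteq> \<tau> \<omega>" by (rule AE_completion[OF AE_lborel_singleton])
  with D have AE: "AE s in lebesgue. s \<in> {t0..\<tau> \<omega>} \<longrightarrow> along running_payoff s \<omega> \<le> - drift s \<omega>"
  proof eventually_elim
    case (elim s)
    show ?case
    proof
      assume "s \<in> {t0..\<tau> \<omega>}"
      then have s: "s \<in> {t0..T}" "s < \<tau> \<omega>" using elim \<tau>(1) by auto
      then have s': "s \<in> {0..T}" using t0 by auto
      have "\<phi> s $ \<omega> s \<noteq> g s (\<omega> s)" using \<tau>(3)[OF s(1)] s(2) by auto
      with obstacle[OF s', of "\<omega> s"] have less: "\<phi> s $ \<omega> s < g s (\<omega> s)" by simp
      have "(\<lambda>r. \<phi> r $ \<omega> s) differentiable (at s within {0..T})"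
        using elim(1) s' unfolding real_differentiable_def by blast
      from upper[OF s' this less] hamiltonian_ge[OF s(1) \<omega> argmin[OF s']]
      show "along running_payoff s \<omega> \<le> - drift s \<omega>" by (simp add: drift_def)
    qed
  qed
  have sub: "set_integrable lebesgue {t0..\<tau> \<omega>} f" if "set_integrable lebesgue {t0..T} f" for f :: "real \<Rightarrow> real"
    using that by (rule set_integrable_subset) (use \<tau>(1) in auto)
  have "(LINT s:{t0..\<tau> \<omega>}|lebesgue. along running_payoff s \<omega>) \<le> (LINT s:{t0..\<tau> \<omega>}|lebesgue. - drift s \<omega>)"
    unfolding set_lebesgue_integral_def
  proof (rule integral_mono_AE)
    show "integrable lebesgue (\<lambda>s. indicat_real {t0..\<tau> \<omega>} s *\<^sub>R along running_payoff s \<omega>)"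
      using sub[OF int2[OF \<omega>]] by (simp add: set_integrable_def)
    show "integrable lebesgue (\<lambda>s. indicat_real {t0..\<tau> \<omega>} s *\<^sub>R - drift s \<omega>)"
      using sub[OF int1[OF \<omega>]] by (simp add: set_integrable_def)
    show "AE s in lebesgue. indicat_real {t0..\<tau> \<omega>} s *\<^sub>R along running_payoff s \<omega>
        \<le> indicat_real {t0..\<tau> \<omega>} s *\<^sub>R - drift s \<omega>"
      using AE by eventually_elim (auto simp: indicator_def)
  qed
  also have "\<dots> = - (LINT s:{t0..\<tau> \<omega>}|lebesgue. drift s \<omega>)"
    by (simp add: set_lebesgue_integral_def)
  finally show ?thesis
    unfolding payoff_eq dynkin_eq \<tau>(2) by simp
qed

end

theorem mainTheorem4:
  fixes T :: real
    and U :: "'u::topological_space set"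
    and V :: "'v::topological_space set"
    and Q :: "real \<Rightarrow> 'u \<Rightarrow> 'v \<Rightarrow> real ^ 's ^ 's::finite"
    and g :: "real \<Rightarrow> 's \<Rightarrow> real"
    and h :: "real \<Rightarrow> 's \<Rightarrow> 'u \<Rightarrow> 'v \<Rightarrow> real"
    and \<phi> :: "real \<Rightarrow> real ^ 's"
    and u_hat :: "real \<Rightarrow> 's \<Rightarrow> 'u"
    and t0 :: real
    and i0 :: 's
    and \<beta> :: "real \<Rightarrow> (real \<Rightarrow> 's) \<Rightarrow> 'v"
    and P :: "(real \<Rightarrow> 's) measure"
  assumes game: "stopping_game T U V Q g h"
    and phi_AC: "\<phi> \<in> AC T"
    and obstacle: "\<And>t i. t \<in> {0..T} \<Longrightarrow> \<phi> t $ i \<le> g t i"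
    and terminal: "\<And>i. \<phi> T $ i = g T i"
    and upper:
      "\<And>t i. t \<in> {0..T} \<Longrightarrow> (\<lambda>s. \<phi> s $ i) differentiable (at t within {0..T}) \<Longrightarrow>
        \<phi> t $ i < g t i \<Longrightarrow> time_deriv T \<phi> t i \<le> - hamiltonian U V Q h t i (\<phi> t)"
    and u_hat_feedback: "u_hat \<in> feedback_strategies T U"
    and u_hat_argmin:
      "\<And>t i. t \<in> {0..T} \<Longrightarrow>
        is_arg_min (\<lambda>u. SUP v\<in>V. pre_hamiltonian Q h t i (\<phi> t) u v) (\<lambda>u. u \<in> U) (u_hat t i)"
    and t0: "t0 \<in> {0..T}"
    and beta: "\<beta> \<in> memory_strategies t0 T V"
    and law: "generated_law T Q t0 i0 (of_feedback u_hat) \<beta> P"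
  shows "(LINT \<omega>|P. payoff g h t0 (of_feedback u_hat) \<beta> (hitting_time T g \<phi> t0 \<omega>) \<omega>)
           \<le> \<phi> t0 $ i0"
proof -
  interpret stopping_game T U V Q g h by fact
  interpret feedback_play T U V Q g h \<phi> u_hat t0 i0 \<beta> P
    by unfold_locales (use phi_AC terminal u_hat_feedback t0 beta law in auto)
  have "(LINT \<omega>|P. payoff g h t0 (of_feedback u_hat) \<beta> (hitting_time T g \<phi> t0 \<omega>) \<omega>)
      \<le> (LINT \<omega>|P. dynkin_process T Q t0 (of_feedback u_hat) \<beta> \<phi> (hitting_time T g \<phi> t0 \<omega>) \<omega>)"
    using payoff_le_dynkin[OF obstacle upper u_hat_argmin]
    by (intro integral_mono payoff_integrable dynkin_stopped(1))
  also have "\<dots> = \<phi> t0 $ i0" by (rule dynkin_stopped(2))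
  finally show ?thesis .
qed

end
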